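(* For all integers $n\ge3$: if $n$ is odd then $s_n\equiv 2 \pmod{2^{(n-1)/2}}$, and if $n$ is even then $s_n\equiv -2\pmod{2^{n/2}}$.
   Context: A block of a permutation $\pi$ of $\{1,\ldots,n\}$ is a nonempty set of consecutive positions whose set of values under $\pi$ is a set of consecutive integers. A permutation of length $n$ is simple if its only blocks are the singletons and $\{1,\ldots,n\}$. $s_n$ is the number of simple permutations of length $n$. *)

theory Defs
  imports "HOL-Combinatorics.Permutations" "HOL-Number_Theory.Cong"
begin

definition consecutive :: "nat set \<Rightarrow> bool" where
  "consecutive A \<longleftrightarrow> (\<exists>a b. A = {a..b})"

definition perm_block :: "nat \<Rightarrow> (nat \<Rightarrow> nat) \<Rightarrow> nat set \<Rightarrow> bool" where
  "perm_block n \<pi> B \<longleftrightarrow>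
     B \<noteq> {} \<and> B \<subseteq> {1..n} \<and> consecutive B \<and> consecutive (\<pi> ` B)"

definition simple_perm :: "nat \<Rightarrow> (nat \<Rightarrow> nat) \<Rightarrow> bool" where
  "simple_perm n \<pi> \<longleftrightarrow> \<pi> permutes {1..n} \<and>
     (\<forall>B. perm_block n \<pi> B \<longrightarrow> is_singleton B \<or> B = {1..n})"

definition num_simple :: "nat \<Rightarrow> nat" where
  "num_simple n = card {\<pi>. simple_perm n \<pi>}"

end

theory Submission
  imports Defs "HOL-Library.Disjoint_Sets" "HOL-Computational_Algebra.Formal_Power_Series"
begin

text \<open>
  Write \<open>F\<close> for the power series with coefficients \<open>n!\<close> for \<open>n \<ge> 1\<close> and constant term \<open>0\<close>, and
  \<open>s\<^sub>k\<close> for the number of simple permutations of length \<open>k\<close>. The proof combines the substitution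
  decomposition of permutations, which gives an identity for \<open>F\<close>, with a short induction on powers
  of two.

  Every permutation of length \<open>n \<ge> 2\<close> is of exactly one of three kinds. It may be a sum, mapping
  some \<open>{1..m}\<close> with \<open>0 < m < n\<close> to itself, or a skew sum, mapping it to the \<open>m\<close> largest values;
  these are the cases in which the positions split into two complementary blocks. Otherwise the
  union of two overlapping proper blocks is again proper (\<open>proper_block_Un\<close>), so that the maximal
  proper blocks partition \<open>{1..n}\<close>, and contracting each of them to a point yields a simple permutation
  of length \<open>k \<ge> 3\<close> (\<open>ex_simple_quotient\<close>). Conversely, replacing the entries of a simple permutation
  of length \<open>k \<ge> 3\<close> by arbitrary blocks yields an indecomposable permutation whose maximal proper
  blocks are the given ones (\<open>inflation_block\<close>, \<open>inflation_maximal_blocks\<close>). The permutations of the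
  third kind of length \<open>n\<close> are therefore counted by the sum over \<open>k \<ge> 3\<close> of \<open>s\<^sub>k\<close> times the coefficient
  of \<open>X ^ n\<close> in \<open>F ^ k\<close>. Splitting off the first indecomposable summand shows that sums, and by symmetry
  skew sums, have the generating function \<open>F\<^sup>2 / (1 + F)\<close>, the alternating sum of the \<open>F ^ k\<close> for
  \<open>k \<ge> 2\<close>. Altogether (\<open>fact_eq_sum_simple\<close>), for \<open>n \<ge> 2\<close>, the number \<open>n!\<close> is the sum over
  \<open>2 \<le> k \<le> n\<close> of \<open>t\<^sub>k\<close> times the coefficient of \<open>X ^ n\<close> in \<open>F ^ k\<close>, where \<open>t\<^sub>2 = 2\<close> and
  \<open>t\<^sub>k = 2 (-1) ^ k + s\<^sub>k\<close> for \<open>k \<ge> 3\<close>.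

  The theorem says that \<open>t\<^sub>n\<close> is divisible by \<open>2 ^ (n div 2)\<close>. The number \<open>n!\<close> is, because it has
  \<open>n div 2\<close> even factors. Consequently the coefficient of \<open>X ^ n\<close> in \<open>F ^ k\<close>, a sum of products of
  \<open>k\<close> factorials, is divisible by 2 to the power \<open>(n - k) / 2\<close> rounded up
  (\<open>power_2_dvd_fact_fps_power\<close>). In the identity for \<open>n!\<close> the number \<open>t\<^sub>n\<close> has coefficient \<open>1\<close> and
  by induction all other terms are divisible by \<open>2 ^ (n div 2)\<close>.
\<close>

section \<open>Consecutive sets and blocks\<close>

text \<open>The description of intervals used below: order-convexity is what survives unions and differences,
  and it also covers the empty set, which is \<open>{1..0}\<close>.\<close>

lemma consecutive_iff:
  "consecutive A \<longleftrightarrow> finite A \<and> (\<forall>x\<in>A. \<forall>z\<in>A. \<forall>y. x \<le> y \<and> y \<le> z \<longrightarrow> y \<in> A)"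
proof
  assume "consecutive A"
  then show "finite A \<and> (\<forall>x\<in>A. \<forall>z\<in>A. \<forall>y. x \<le> y \<and> y \<le> z \<longrightarrow> y \<in> A)"
    unfolding consecutive_def by auto
next
  assume *: "finite A \<and> (\<forall>x\<in>A. \<forall>z\<in>A. \<forall>y. x \<le> y \<and> y \<le> z \<longrightarrow> y \<in> A)"
  show "consecutive A"
  proof (cases "A = {}")
    case True
    then have "A = {1..0}" by simp
    then show ?thesis unfolding consecutive_def by blast
  next
    case False
    with *[THEN conjunct1] have "Min A \<in> A" "Max A \<in> A" by auto
    have "{Min A..Max A} \<subseteq> A"
      by (rule subsetI, rule *[THEN conjunct2, rule_format, OF \<open>Min A \<in> A\<close> \<open>Max A \<in> A\<close>]) simp
    moreover have "A \<subseteq> {Min A..Max A}" using *[THEN conjunct1] by (simp add: subset_iff)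
    ultimately have "A = {Min A..Max A}" by (rule antisym[rotated])
    then show ?thesis unfolding consecutive_def by blast
  qed
qed

lemma consecutive_convexD: "consecutive A \<Longrightarrow> x \<in> A \<Longrightarrow> z \<in> A \<Longrightarrow> {x..z} \<subseteq> A"
  unfolding consecutive_def by auto

lemma consecutive_atLeastAtMost [simp]: "consecutive {a..b}"
  unfolding consecutive_def by blast

lemma consecutive_singleton [simp]: "consecutive {a}"
  by (simp add: consecutive_iff)

lemma consecutive_Un:
  assumes "consecutive A" "consecutive B" "A \<inter> B \<noteq> {}"
  shows "consecutive (A \<union> B)"
proof -
  obtain c where c: "c \<in> A" "c \<in> B" using assms by blast
  have A: "finite A" "\<And>x y z. x \<in> A \<Longrightarrow> z \<in> A \<Longrightarrow> x \<le> y \<Longrightarrow> y \<le> z \<Longrightarrow> y \<in> A"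
    and B: "finite B" "\<And>x y z. x \<in> B \<Longrightarrow> z \<in> B \<Longrightarrow> x \<le> y \<Longrightarrow> y \<le> z \<Longrightarrow> y \<in> B"
    using assms unfolding consecutive_iff by blast+
  have "y \<in> A \<union> B" if xz: "x \<in> A \<union> B" "z \<in> A \<union> B" and y: "x \<le> y" "y \<le> z" for x y z
  proof (cases "y \<le> c")
    case True
    then show ?thesis using xz(1) c A(2)[of x c y] B(2)[of x c y] y by blast
  next
    case False
    then show ?thesis using xz(2) c A(2)[of c z y] B(2)[of c z y] y by auto
  qed
  then show ?thesis unfolding consecutive_iff using A(1) B(1) by blast
qed

text \<open>Convexity of \<open>A - B\<close> could only fail if \<open>B\<close> sat strictly inside \<open>A\<close>; a point \<open>d\<close> of \<open>B\<close>
  outside \<open>A\<close> lies to one side of \<open>A\<close>, so that \<open>B\<close> contains everything of \<open>A\<close> on that side of any of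
  its points.\<close>

lemma consecutive_Diff:
  assumes "consecutive A" "consecutive B" "A \<inter> B \<noteq> {}" "\<not> B \<subseteq> A"
  shows "consecutive (A - B)"
proof -
  obtain c d where c: "c \<in> A" "c \<in> B" and d: "d \<in> B" "d \<notin> A" using assms by auto
  have A: "finite A" "\<And>x y z. x \<in> A \<Longrightarrow> z \<in> A \<Longrightarrow> x \<le> y \<Longrightarrow> y \<le> z \<Longrightarrow> y \<in> A"
    and B: "\<And>x y z. x \<in> B \<Longrightarrow> z \<in> B \<Longrightarrow> x \<le> y \<Longrightarrow> y \<le> z \<Longrightarrow> y \<in> B"
    using assms unfolding consecutive_iff by blast+
  have "y \<notin> B" if x: "x \<in> A" "x \<notin> B" and z: "z \<in> A" "z \<notin> B" and y: "x \<le> y" "y \<le> z" for x y z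
  proof
    assume "y \<in> B"
    have "d < x \<or> z < d" using A(2)[OF x(1) z(1), of d] d by linarith
    then show False
      using B[OF d(1) \<open>y \<in> B\<close>, of x] B[OF \<open>y \<in> B\<close> d(1), of z] x z y by auto
  qed
  then show ?thesis unfolding consecutive_iff using A by blast
qed

lemma perm_block_Un:
  assumes "perm_block n \<pi> A" "perm_block n \<pi> B" "A \<inter> B \<noteq> {}"
  shows "perm_block n \<pi> (A \<union> B)"
  using assms unfolding perm_block_def image_Un by (auto intro!: consecutive_Un)

lemma perm_block_Diff:
  assumes "inj \<pi>" "perm_block n \<pi> A" "perm_block n \<pi> B" "A \<inter> B \<noteq> {}" "\<not> A \<subseteq> B" "\<not> B \<subseteq> A"
  shows "perm_block n \<pi> (A - B)"
  using assms unfolding perm_block_def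
  by (auto simp: image_set_diff inj_image_subset_iff intro!: consecutive_Diff)

section \<open>Decomposable permutations\<close>

text \<open>Two complementary blocks are an initial and a final segment, and so are their images. Hence this
  notion unites the two ways of splitting a permutation into two parts, the sums
  (\<open>12\<close> inflated) and the skew sums (\<open>21\<close> inflated), without mentioning positions; the enumeration
  needs the two kinds separately.\<close>

definition decomposable :: "nat \<Rightarrow> (nat \<Rightarrow> nat) \<Rightarrow> bool" where
  "decomposable n \<pi> \<longleftrightarrow> (\<exists>A. perm_block n \<pi> A \<and> perm_block n \<pi> ({1..n} - A))"

definition sum_decomposable :: "nat \<Rightarrow> (nat \<Rightarrow> nat) \<Rightarrow> bool" where
  "sum_decomposable n \<pi> \<longleftrightarrow> (\<exists>m. 0 < m \<and> m < n \<and> \<pi> ` {1..m} = {1..m})"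

definition skew_decomposable :: "nat \<Rightarrow> (nat \<Rightarrow> nat) \<Rightarrow> bool" where
  "skew_decomposable n \<pi> \<longleftrightarrow> (\<exists>m. 0 < m \<and> m < n \<and> \<pi> ` {1..m} = {Suc (n - m)..n})"

lemma initial_interval:
  fixes A :: "nat set"
  assumes "consecutive A" "A \<subseteq> {1..n}" "1 \<in> A"
  shows "A = {1..card A}"
proof -
  obtain a b where A: "A = {a..b}" using assms unfolding consecutive_def by blast
  with assms have "a = 1" by auto
  with A show ?thesis by simp
qed

lemma final_interval:
  fixes A :: "nat set"
  assumes "consecutive A" "A \<subseteq> {1..n}" "n \<in> A"
  shows "A = {Suc (n - card A)..n}"
proof -
  obtain a b where A: "A = {a..b}" using assms unfolding consecutive_def by blast
  with assms have "b = n" "1 \<le> a" "a \<le> n" by auto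
  with A show ?thesis by simp
qed

lemma decomposable_iff:
  assumes "\<pi> permutes {1..n}"
  shows "decomposable n \<pi> \<longleftrightarrow> sum_decomposable n \<pi> \<or> skew_decomposable n \<pi>"
proof
  assume "decomposable n \<pi>"
  then obtain A0 where A0: "perm_block n \<pi> A0" "perm_block n \<pi> ({1..n} - A0)"
    unfolding decomposable_def by blast
  then have "{1..n} - ({1..n} - A0) = A0" "n \<ge> 1" unfolding perm_block_def by auto
  \<comment> \<open>By symmetry, \<open>A\<close> is chosen to be the one of the two blocks that contains \<open>1\<close>.\<close>
  with A0 obtain A where A: "perm_block n \<pi> A" "perm_block n \<pi> ({1..n} - A)" "1 \<in> A"
    by (metis DiffI atLeastAtMost_iff order_refl)
  define m where "m = card A"
  have sub: "A \<subseteq> {1..n}" "A \<noteq> {}" "{1..n} - A \<noteq> {}" using A unfolding perm_block_def by auto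
  have Am: "A = {1..m}" unfolding m_def
    using A sub by (intro initial_interval) (auto simp: perm_block_def)
  have m: "0 < m" "m < n" using sub unfolding Am by auto
  let ?V = "\<pi> ` A"
  have V: "consecutive ?V" "?V \<subseteq> {1..n}" "card ?V = m"
    using A permutes_image[OF assms] sub card_image[OF permutes_inj_on[OF assms]]
    by (auto simp: perm_block_def m_def)
  have compl: "\<pi> ` ({1..n} - A) = {1..n} - ?V"
    using assms by (simp add: image_set_diff permutes_inj permutes_image)
  \<comment> \<open>The image must reach one end of \<open>{1..n}\<close>, since otherwise its complement, an interval too,
    would contain both ends.\<close>
  consider "1 \<in> ?V" | "n \<in> ?V" | "1 \<notin> ?V" "n \<notin> ?V" by blast
  then show "sum_decomposable n \<pi> \<or> skew_decomposable n \<pi>"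
  proof cases
    case 1
    then have "?V = {1..m}" using initial_interval[OF V(1,2)] V(3) by simp
    then show ?thesis using m Am unfolding sum_decomposable_def by blast
  next
    case 2
    then have "?V = {Suc (n - m)..n}" using final_interval[OF V(1,2)] V(3) by simp
    then show ?thesis using m Am unfolding skew_decomposable_def by blast
  next
    case 3
    have "consecutive ({1..n} - ?V)" using A compl unfolding perm_block_def by simp
    moreover have "1 \<in> {1..n} - ?V" "n \<in> {1..n} - ?V" using 3 \<open>n \<ge> 1\<close> by auto
    ultimately have "{1..n} \<subseteq> {1..n} - ?V" by (rule consecutive_convexD)
    then have "?V = {}" using V by auto
    then show ?thesis using sub by simp
  qed
next
  have *: "decomposable n \<pi>" if "0 < m" "m < n" "consecutive (\<pi> ` {1..m})" "consecutive ({1..n} - \<pi> ` {1..m})" for m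
  proof -
    have "{1..n} - {1..m} = {Suc m..n}" using that by auto
    moreover have "\<pi> ` ({1..n} - {1..m}) = {1..n} - \<pi> ` {1..m}"
      using assms by (simp add: image_set_diff permutes_inj permutes_image)
    ultimately show ?thesis unfolding decomposable_def perm_block_def using that
      by (intro exI[of _ "{1..m}"]) auto
  qed
  assume "sum_decomposable n \<pi> \<or> skew_decomposable n \<pi>"
  then show "decomposable n \<pi>"
  proof
    assume "sum_decomposable n \<pi>"
    then obtain m where m: "0 < m" "m < n" "\<pi> ` {1..m} = {1..m}" unfolding sum_decomposable_def by blast
    moreover have "{1..n} - {1..m} = {Suc m..n}" using m by auto
    ultimately show ?thesis by (intro *[of m]) auto
  next
    assume "skew_decomposable n \<pi>"
    then obtain m where m: "0 < m" "m < n" "\<pi> ` {1..m} = {Suc (n - m)..n}" unfolding skew_decomposable_def by blast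
    moreover have "{1..n} - {Suc (n - m)..n} = {1..n - m}" using m by auto
    ultimately show ?thesis by (intro *[of m]) auto
  qed
qed

text \<open>Of the two initial segments \<open>{1..a}\<close> and \<open>{1..b}\<close> one contains the other, hence the same holds for
  their images \<open>{1..a}\<close> and \<open>{Suc (n - b)..n}\<close>: comparing the smallest or the largest elements
  forces \<open>b = n\<close> or \<open>a = n\<close>.\<close>

lemma not_sum_and_skew_decomposable: "\<not> (sum_decomposable n \<pi> \<and> skew_decomposable n \<pi>)"
proof
  assume "sum_decomposable n \<pi> \<and> skew_decomposable n \<pi>"
  then obtain a b where a: "0 < a" "a < n" "\<pi> ` {1..a} = {1..a}"
    and b: "0 < b" "b < n" "\<pi> ` {1..b} = {Suc (n - b)..n}"
    unfolding sum_decomposable_def skew_decomposable_def by blast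
  show False
  proof (cases "a \<le> b")
    case True
    then have "{1..a} \<subseteq> {Suc (n - b)..n}" using a b by (metis atLeastatMost_subset_iff image_mono order_refl)
    then show False using a b by auto
  next
    case False
    then have "{Suc (n - b)..n} \<subseteq> {1..a}" using a b by (metis atLeastatMost_subset_iff image_mono order_refl nle_le)
    then show False using a b by auto
  qed
qed

section \<open>Maximal proper blocks\<close>

definition proper_block :: "nat \<Rightarrow> (nat \<Rightarrow> nat) \<Rightarrow> nat set \<Rightarrow> bool" where
  "proper_block n \<pi> B \<longleftrightarrow> perm_block n \<pi> B \<and> B \<noteq> {1..n}"

definition maximal_blocks :: "nat \<Rightarrow> (nat \<Rightarrow> nat) \<Rightarrow> nat set set" where
  "maximal_blocks n \<pi> = {B. proper_block n \<pi> B \<and> (\<forall>B'. proper_block n \<pi> B' \<and> B \<subseteq> B' \<longrightarrow> B' = B)}"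

text \<open>If two overlapping proper blocks covered everything, then \<open>A - B\<close> would be a block complementary to
  \<open>B\<close>. This is why the maximal proper blocks of an indecomposable permutation are disjoint.\<close>

lemma proper_block_Un:
  assumes "\<pi> permutes {1..n}" "\<not> decomposable n \<pi>"
    and A: "proper_block n \<pi> A" and B: "proper_block n \<pi> B" and "A \<inter> B \<noteq> {}"
  shows "proper_block n \<pi> (A \<union> B)"
proof -
  have "A \<union> B \<noteq> {1..n}"
  proof
    assume all: "A \<union> B = {1..n}"
    have "\<not> A \<subseteq> B" "\<not> B \<subseteq> A" using all A B unfolding proper_block_def by auto
    then have "perm_block n \<pi> (A - B)"
      using assms by (intro perm_block_Diff) (auto simp: proper_block_def permutes_inj)
    moreover have "{1..n} - B = A - B" using all by blast
    ultimately show False using assms B unfolding decomposable_def proper_block_def by auto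
  qed
  with perm_block_Un[of n \<pi> A B] assms show ?thesis by (auto simp: proper_block_def)
qed

lemma ex_maximal_block:
  assumes "proper_block n \<pi> B"
  obtains M where "M \<in> maximal_blocks n \<pi>" "B \<subseteq> M"
proof -
  have "{B. proper_block n \<pi> B} \<subseteq> Pow {1..n}" unfolding proper_block_def perm_block_def by blast
  then have "finite {B. proper_block n \<pi> B}" by (rule finite_subset) simp
  from finite_has_maximal2[OF this, of B] assms that show ?thesis
    unfolding maximal_blocks_def by auto
qed

text \<open>An interval partition of \<open>{1..n}\<close> with \<open>k\<close> parts is a composition of \<open>n\<close> into \<open>k\<close> positive
  summands. Keeping it as a set of sets allows the maximal blocks of a permutation to be one of them
  literally.\<close>

definition interval_partitions :: "nat \<Rightarrow> nat \<Rightarrow> nat set set set" where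
  "interval_partitions n k = {P. partition_on {1..n} P \<and> (\<forall>B\<in>P. consecutive B) \<and> card P = k}"

lemma finite_interval_partitions: "finite (interval_partitions n k)"
  by (rule finite_subset[of _ "Pow (Pow {1..n})"]) (auto simp: interval_partitions_def partition_on_def)

lemma partition_on_maximal_blocks:
  assumes "\<pi> permutes {1..n}" "\<not> decomposable n \<pi>" "n \<ge> 2"
  shows "partition_on {1..n} (maximal_blocks n \<pi>)"
proof (rule partition_onI)
  show "\<Union> (maximal_blocks n \<pi>) = {1..n}"
  proof
    show "\<Union> (maximal_blocks n \<pi>) \<subseteq> {1..n}"
      unfolding maximal_blocks_def proper_block_def perm_block_def by blast
    show "{1..n} \<subseteq> \<Union> (maximal_blocks n \<pi>)"
    proof
      fix x assume x: "x \<in> {1..n}"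
      have "{x} \<noteq> {1..n}"
      proof
        assume "{x} = {1..n}"
        then have "card {1..n} = 1" by (metis is_singletonI is_singleton_altdef)
        with assms show False by simp
      qed
      with x have "proper_block n \<pi> {x}"
        by (simp add: proper_block_def perm_block_def)
      then show "x \<in> \<Union> (maximal_blocks n \<pi>)" by (rule ex_maximal_block) auto
    qed
  qed
  show "{} \<notin> maximal_blocks n \<pi>"
    unfolding maximal_blocks_def proper_block_def perm_block_def by blast
  fix p q assume pq: "p \<in> maximal_blocks n \<pi>" "q \<in> maximal_blocks n \<pi>" "p \<noteq> q"
  show "disjnt p q"
  proof (rule ccontr)
    assume "\<not> disjnt p q"
    then have "proper_block n \<pi> (p \<union> q)"
      using pq assms by (intro proper_block_Un) (auto simp: maximal_blocks_def disjnt_def)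
    then have "p \<union> q = p" "p \<union> q = q" using pq unfolding maximal_blocks_def by blast+
    then show False using pq by blast
  qed
qed

text \<open>A single maximal block would be the whole of \<open>{1..n}\<close>, which is not proper; two of them would be
  complementary blocks.\<close>

lemma card_maximal_blocks:
  assumes "\<pi> permutes {1..n}" "\<not> decomposable n \<pi>" "n \<ge> 2"
  shows "card (maximal_blocks n \<pi>) \<ge> 3"
proof -
  let ?P = "maximal_blocks n \<pi>"
  have part: "partition_on {1..n} ?P" using assms by (rule partition_on_maximal_blocks)
  have fin: "finite ?P" using part by (auto intro: finite_elements)
  have "card ?P \<noteq> 0" using part fin assms by (auto simp: partition_on_def)
  moreover have "card ?P \<noteq> 1"
  proof
    assume "card ?P = 1"
    then obtain A where A: "?P = {A}" by (rule card_1_singletonE)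
    then have "A = {1..n}" using part by (simp add: partition_on_def)
    then show False using A unfolding maximal_blocks_def proper_block_def by blast
  qed
  moreover have "card ?P \<noteq> 2"
  proof
    assume "card ?P = 2"
    then obtain A B where AB: "?P = {A, B}" "A \<noteq> B" by (auto simp: card_2_iff)
    then have "A \<union> B = {1..n}" "A \<inter> B = {}" using part by (auto simp: partition_on_def disjoint_def)
    then have "{1..n} - A = B" by blast
    moreover have "A \<in> ?P" "B \<in> ?P" using AB by auto
    then have "perm_block n \<pi> A" "perm_block n \<pi> B"
      unfolding maximal_blocks_def proper_block_def by auto
    ultimately show False using assms unfolding decomposable_def by auto
  qed
  ultimately show ?thesis by linarith
qed

section \<open>Ordered interval partitions\<close>

text \<open>\<open>W j\<close> is the part number \<open>\<sigma> j\<close> from the left in an interval partition of \<open>{1..n}\<close> into \<open>k\<close> parts;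
  that the parts are intervals follows from the order relation between them and from their covering
  \<open>{1..n}\<close>. With \<open>\<sigma> = id\<close> this describes the blocks of a permutation by position; the images of these
  blocks are then ordered by the quotient permutation \<open>\<sigma>\<close>. Both situations obey the same lemmas.\<close>

definition ordered_parts :: "nat \<Rightarrow> nat \<Rightarrow> (nat \<Rightarrow> nat) \<Rightarrow> (nat \<Rightarrow> nat set) \<Rightarrow> bool" where
  "ordered_parts n k \<sigma> W \<longleftrightarrow> \<sigma> permutes {1..k} \<and> (\<forall>j\<in>{1..k}. W j \<noteq> {}) \<and>
     (\<Union>j\<in>{1..k}. W j) = {1..n} \<and>
     (\<forall>i\<in>{1..k}. \<forall>j\<in>{1..k}. \<sigma> i < \<sigma> j \<longrightarrow> (\<forall>x\<in>W i. \<forall>y\<in>W j. x < y))"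

lemma ordered_partsD:
  assumes "ordered_parts n k \<sigma> W"
  shows "\<sigma> permutes {1..k}"
    and "\<And>j. j \<in> {1..k} \<Longrightarrow> W j \<noteq> {}"
    and "\<And>j. j \<in> {1..k} \<Longrightarrow> W j \<subseteq> {1..n}"
    and "\<And>y. y \<in> {1..n} \<Longrightarrow> \<exists>j\<in>{1..k}. y \<in> W j"
    and "\<And>i j x y. i \<in> {1..k} \<Longrightarrow> j \<in> {1..k} \<Longrightarrow> \<sigma> i < \<sigma> j \<Longrightarrow> x \<in> W i \<Longrightarrow> y \<in> W j \<Longrightarrow> x < y"
    and "\<And>i j x y. i \<in> {1..k} \<Longrightarrow> j \<in> {1..k} \<Longrightarrow> x \<in> W i \<Longrightarrow> y \<in> W j \<Longrightarrow> x \<le> y \<Longrightarrow> \<sigma> i \<le> \<sigma> j"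
proof -
  note * = assms[unfolded ordered_parts_def]
  show "\<sigma> permutes {1..k}" using * by blast
  show "W j \<noteq> {}" if "j \<in> {1..k}" for j using * that by blast
  show "W j \<subseteq> {1..n}" if "j \<in> {1..k}" for j using * that by blast
  show "\<exists>j\<in>{1..k}. y \<in> W j" if "y \<in> {1..n}" for y using * that by blast
  show lt: "x < y" if "i \<in> {1..k}" "j \<in> {1..k}" "\<sigma> i < \<sigma> j" "x \<in> W i" "y \<in> W j" for i j x y
    using * that by blast
  show "\<sigma> i \<le> \<sigma> j" if "i \<in> {1..k}" "j \<in> {1..k}" "x \<in> W i" "y \<in> W j" "x \<le> y" for i j x y
    using lt[of j i y x] that by (meson leD leI)
qed

lemma ordered_parts_cong:
  assumes W: "ordered_parts n k \<sigma> W" and eq: "\<And>j. j \<in> {1..k} \<Longrightarrow> W' j = W j"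
  shows "ordered_parts n k \<sigma> W'"
  unfolding ordered_parts_def
proof (intro conjI ballI impI)
  have "(\<Union>j\<in>{1..k}. W' j) = (\<Union>j\<in>{1..k}. W j)" by (intro SUP_cong refl eq)
  also have "\<dots> = {1..n}" using W unfolding ordered_parts_def by blast
  finally show "(\<Union>j\<in>{1..k}. W' j) = {1..n}" .
  show "x < y" if "i \<in> {1..k}" "j \<in> {1..k}" "\<sigma> i < \<sigma> j" "x \<in> W' i" "y \<in> W' j" for i j x y
    using ordered_partsD(5)[OF W that(1-3)] that(4,5) unfolding eq[OF that(1)] eq[OF that(2)] .
  show "W' j \<noteq> {}" if "j \<in> {1..k}" for j
    unfolding eq[OF that] by (rule ordered_partsD(2)[OF W that])
qed (rule ordered_partsD(1)[OF W])

lemma ordered_parts_disjoint: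
  assumes "ordered_parts n k \<sigma> W" "i \<in> {1..k}" "j \<in> {1..k}" "x \<in> W i" "x \<in> W j"
  shows "i = j"
proof -
  have "\<sigma> i = \<sigma> j"
    using ordered_partsD(6)[OF assms(1)] assms(2-5) by (meson antisym order_refl)
  then show ?thesis using ordered_partsD(1)[OF assms(1)] by (simp add: permutes_inj inj_eq)
qed

lemma ordered_parts_disjoint_family:
  assumes "ordered_parts n k \<sigma> W"
  shows "disjoint_family_on W {1..k}"
  unfolding disjoint_family_on_def using ordered_parts_disjoint[OF assms] by blast

lemma ordered_parts_inj:
  assumes "ordered_parts n k \<sigma> W"
  shows "inj_on W {1..k}"
  using ordered_parts_disjoint[OF assms] ordered_partsD(2)[OF assms]
  by (intro inj_onI) (metis ex_in_conv)

text \<open>This and \<open>consecutive_ordered_parts_meeting\<close> below translate intervals of \<open>{1..n}\<close> into intervals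
  of part numbers and back. Applied to the positions and to the values at once, they turn blocks of a
  quotient into blocks of the inflated permutation and conversely.\<close>

lemma consecutive_UN_ordered_parts:
  assumes W: "ordered_parts n k \<sigma> W" and K: "K \<subseteq> {1..k}" "consecutive (\<sigma> ` K)"
  shows "consecutive (\<Union>j\<in>K. W j)"
  unfolding consecutive_iff
proof (intro conjI ballI allI impI)
  have "(\<Union>j\<in>K. W j) \<subseteq> {1..n}" using ordered_partsD(3)[OF W] K by blast
  then show fin: "finite (\<Union>j\<in>K. W j)" by (rule finite_subset) simp
  fix x z y assume "x \<in> (\<Union>j\<in>K. W j)" "z \<in> (\<Union>j\<in>K. W j)" and y: "x \<le> y \<and> y \<le> z"
  then obtain i j where i: "i \<in> K" "x \<in> W i" and j: "j \<in> K" "z \<in> W j" by blast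
  have "x \<in> {1..n}" "z \<in> {1..n}" using i j ordered_partsD(3)[OF W] K by blast+
  with y have "y \<in> {1..n}" by auto
  then obtain l where l: "l \<in> {1..k}" "y \<in> W l" using ordered_partsD(4)[OF W] by blast
  have "\<sigma> i \<le> \<sigma> l" "\<sigma> l \<le> \<sigma> j"
    using ordered_partsD(6)[OF W] i j l y K by blast+
  then have "\<sigma> l \<in> \<sigma> ` K"
    using consecutive_convexD[OF K(2), of "\<sigma> i" "\<sigma> j"] i j by auto
  then have "l \<in> K" using ordered_partsD(1)[OF W] by (simp add: permutes_inj inj_image_mem_iff)
  with l show "y \<in> (\<Union>j\<in>K. W j)" by blast
qed

lemma consecutive_ordered_part:
  assumes "ordered_parts n k \<sigma> W" "j \<in> {1..k}"
  shows "consecutive (W j)"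
  using consecutive_UN_ordered_parts[of n k \<sigma> W "{j}"] assms by simp

lemma ordered_part_between:
  assumes W: "ordered_parts n k \<sigma> W" and S: "consecutive S"
    and i: "i \<in> {1..k}" "W i \<inter> S \<noteq> {}" and j: "j \<in> {1..k}" "W j \<inter> S \<noteq> {}"
    and l: "l \<in> {1..k}" "\<sigma> i < \<sigma> l" "\<sigma> l < \<sigma> j"
  shows "W l \<subseteq> S"
proof
  fix y assume y: "y \<in> W l"
  obtain x z where x: "x \<in> W i" "x \<in> S" and z: "z \<in> W j" "z \<in> S" using i j by blast
  have "x < y" "y < z" using ordered_partsD(5)[OF W] i j l x y z by blast+
  then show "y \<in> S" using consecutive_convexD[OF S x(2) z(2)] by auto
qed

lemma consecutive_ordered_parts_meeting:
  assumes W: "ordered_parts n k \<sigma> W" and S: "consecutive S"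
  shows "consecutive (\<sigma> ` {j \<in> {1..k}. W j \<inter> S \<noteq> {}})"
  unfolding consecutive_iff
proof (intro conjI ballI allI impI)
  let ?K = "{j \<in> {1..k}. W j \<inter> S \<noteq> {}}"
  show "finite (\<sigma> ` ?K)" by simp
  fix s u t assume "s \<in> \<sigma> ` ?K" "u \<in> \<sigma> ` ?K" and t: "s \<le> t \<and> t \<le> u"
  then obtain i j where i: "i \<in> ?K" "s = \<sigma> i" and j: "j \<in> ?K" "u = \<sigma> j" by blast
  have perm: "\<sigma> permutes {1..k}" using W by (rule ordered_partsD)
  have "\<sigma> i \<in> {1..k}" "\<sigma> j \<in> {1..k}" using i j permutes_in_image[OF perm] by blast+
  then have "t \<in> {1..k}" using t i j by auto
  then obtain l where l: "l \<in> {1..k}" "t = \<sigma> l" using permutes_image[OF perm] by blast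
  show "t \<in> \<sigma> ` ?K"
  proof (cases "t = s \<or> t = u")
    case True
    then show ?thesis using i j by blast
  next
    case False
    then have "\<sigma> i < \<sigma> l" "\<sigma> l < \<sigma> j" using t i j l by auto
    then have "W l \<subseteq> S" using ordered_part_between[OF W S] i j l by blast
    then have "l \<in> ?K" using ordered_partsD(2)[OF W l(1)] l by blast
    then show ?thesis using l by blast
  qed
qed

lemma permutes_rank:
  assumes "\<sigma> permutes {1..k}" "j \<in> {1..k}"
  shows "card {i \<in> {1..k}. \<sigma> i \<le> \<sigma> j} = (\<sigma> j :: nat)"
proof -
  have "\<sigma> ` {i \<in> {1..k}. \<sigma> i \<le> \<sigma> j} = {1..\<sigma> j}"
  proof
    show "\<sigma> ` {i \<in> {1..k}. \<sigma> i \<le> \<sigma> j} \<subseteq> {1..\<sigma> j}"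
      using permutes_in_image[OF assms(1)] by fastforce
    show "{1..\<sigma> j} \<subseteq> \<sigma> ` {i \<in> {1..k}. \<sigma> i \<le> \<sigma> j}"
    proof
      fix t assume t: "t \<in> {1..\<sigma> j}"
      moreover have "\<sigma> j \<in> {1..k}" using permutes_in_image[OF assms(1)] assms(2) by blast
      ultimately have "t \<in> \<sigma> ` {1..k}" using permutes_image[OF assms(1)] by auto
      with t show "t \<in> \<sigma> ` {i \<in> {1..k}. \<sigma> i \<le> \<sigma> j}" by auto
    qed
  qed
  then show ?thesis
    using card_image[OF permutes_inj_on[OF assms(1)]] by (metis card_atLeastAtMost diff_Suc_1)
qed

text \<open>A permutation of \<open>{1..k}\<close> is determined by the order of its values, since \<open>\<sigma> j\<close> is the rank of \<open>j\<close>;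
  and the order is read off from the parts, which are nonempty. Hence a permutation has at most one
  quotient with respect to given blocks.\<close>

lemma ordered_parts_order_unique:
  assumes "ordered_parts n k \<sigma> W" "ordered_parts n k \<tau> W"
  shows "\<sigma> = \<tau>"
proof
  fix j
  have *: "\<sigma>' i \<le> \<sigma>' j" if prem: "ordered_parts n k \<sigma>' W" "ordered_parts n k \<tau>' W" "i \<in> {1..k}" "j \<in> {1..k}" "\<tau>' i \<le> \<tau>' j"
    for \<sigma>' \<tau>' i j
  proof (cases "i = j")
    case False
    then have "\<tau>' i \<noteq> \<tau>' j" using ordered_partsD(1)[OF prem(2)] by (simp add: permutes_inj inj_eq)
    then have "\<tau>' i < \<tau>' j" using prem by simp
    moreover obtain x y where "x \<in> W i" "y \<in> W j" using ordered_partsD(2)[OF prem(1)] prem(3,4) by blast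
    ultimately show ?thesis
      using ordered_partsD(5)[OF prem(2,3,4)] ordered_partsD(6)[OF prem(1,3,4)] by (meson less_imp_le)
  qed simp
  have perm: "\<sigma> permutes {1..k}" "\<tau> permutes {1..k}" using assms ordered_partsD(1) by blast+
  show "\<sigma> j = \<tau> j"
  proof (cases "j \<in> {1..k}")
    case True
    then have "{i \<in> {1..k}. \<sigma> i \<le> \<sigma> j} = {i \<in> {1..k}. \<tau> i \<le> \<tau> j}"
      using *[OF assms] *[OF assms(2,1)] by blast
    then show ?thesis using permutes_rank perm True by metis
  qed (use perm in \<open>simp add: permutes_not_in\<close>)
qed

text \<open>Parts are ranked by their least elements. Two disjoint intervals whose least elements are ordered
  are ordered element by element.\<close>

lemma ex_ordered_parts:
  assumes cons: "\<And>j. j \<in> {1..k} \<Longrightarrow> consecutive (W j)" and ne: "\<And>j. j \<in> {1..k} \<Longrightarrow> W j \<noteq> {}"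
    and disj: "disjoint_family_on W {1..k}" and cover: "(\<Union>j\<in>{1..k}. W j) = {1..n}"
  shows "\<exists>\<sigma>. ordered_parts n k \<sigma> W"
proof -
  define f where "f j = Min (W j)" for j
  define \<sigma> where "\<sigma> j = (if j \<in> {1..k} then card {i \<in> {1..k}. f i \<le> f j} else j)" for j
  have fin: "finite (W j)" if "j \<in> {1..k}" for j using cons that unfolding consecutive_iff by blast
  have f: "f j \<in> W j" if "j \<in> {1..k}" for j unfolding f_def using fin ne that by (intro Min_in)
  have f_le: "f j \<le> x" if "j \<in> {1..k}" "x \<in> W j" for j x unfolding f_def using fin that by (intro Min_le)
  have mono: "\<sigma> i \<le> \<sigma> j" if "i \<in> {1..k}" "j \<in> {1..k}" "f i \<le> f j" for i j
  proof -
    have "card {l \<in> {1..k}. f l \<le> f i} \<le> card {l \<in> {1..k}. f l \<le> f j}"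
      using that(3) by (intro card_mono) auto
    with that show ?thesis by (simp add: \<sigma>_def)
  qed
  have strict: "\<sigma> i < \<sigma> j" if "i \<in> {1..k}" "j \<in> {1..k}" "f i < f j" for i j
  proof -
    have "card {l \<in> {1..k}. f l \<le> f i} < card {l \<in> {1..k}. f l \<le> f j}"
      using that by (intro psubset_card_mono psubsetI) (auto dest: leD)
    with that show ?thesis by (simp add: \<sigma>_def)
  qed
  have f_inj: "f i \<noteq> f j" if "i \<in> {1..k}" "j \<in> {1..k}" "i \<noteq> j" for i j
    using f[OF that(1)] f[OF that(2)] disjoint_family_onD[OF disj that] by auto
  have "inj_on \<sigma> {1..k}"
    using strict f_inj by (intro inj_onI) (metis less_irrefl linorder_neqE_nat)
  moreover have "\<sigma> j \<in> {1..k}" if "j \<in> {1..k}" for j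
  proof -
    have "card {i \<in> {1..k}. f i \<le> f j} \<le> card {1..k}" by (intro card_mono) auto
    moreover have "{i \<in> {1..k}. f i \<le> f j} \<noteq> {}" using that by blast
    then have "card {i \<in> {1..k}. f i \<le> f j} > 0" by (simp add: card_gt_0_iff)
    ultimately show ?thesis using that by (simp add: \<sigma>_def)
  qed
  ultimately have "bij_betw \<sigma> {1..k} {1..k}"
    by (metis bij_betw_def endo_inj_surj finite_atLeastAtMost image_subsetI)
  then have "\<sigma> permutes {1..k}" by (rule bij_imp_permutes) (auto simp: \<sigma>_def)
  moreover have "x < y" if ij: "i \<in> {1..k}" "j \<in> {1..k}" "\<sigma> i < \<sigma> j" and xy: "x \<in> W i" "y \<in> W j" for i j x y
  proof (rule ccontr)
    assume "\<not> x < y"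
    have "f i < f j" using mono[of j i] ij by linarith
    also have "f j \<le> y" using f_le ij xy by blast
    finally have "y \<in> W i"
      using consecutive_convexD[OF cons[OF ij(1)] f[OF ij(1)] xy(1)] \<open>\<not> x < y\<close> by auto
    moreover have "i \<noteq> j" using ij by auto
    ultimately show False using disj ij xy unfolding disjoint_family_on_def by blast
  qed
  ultimately have "ordered_parts n k \<sigma> W" unfolding ordered_parts_def using ne cover by blast
  then show ?thesis by blast
qed

lemma ex_enumeration_interval_partition:
  assumes "P \<in> interval_partitions n k"
  obtains g where "g ` {1..k} = P" "ordered_parts n k id g"
proof -
  have P: "partition_on {1..n} P" "\<And>B. B \<in> P \<Longrightarrow> consecutive B" "card P = k"
    using assms unfolding interval_partitions_def by auto
  have "finite P" using P(1) by (auto intro: finite_elements)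
  then obtain h where h: "bij_betw h {1..k} P"
    using finite_same_card_bij[of "{1..k}" P] P(3) by auto
  then have img: "h ` {1..k} = P" and inj: "inj_on h {1..k}" by (auto simp: bij_betw_def)
  have "disjoint_family_on h {1..k}"
    using P(1) img inj unfolding disjoint_family_on_def partition_on_def disjoint_def inj_on_def
    by (metis imageI)
  then obtain \<sigma> where \<sigma>: "ordered_parts n k \<sigma> h"
    using ex_ordered_parts[of k h n] P img unfolding partition_on_def by (metis imageI)
  \<comment> \<open>Renumbering an arbitrary enumeration \<open>h\<close> by its own order makes it increasing.\<close>
  have perm: "\<sigma> permutes {1..k}" using \<sigma> by (rule ordered_partsD)
  have inv: "inv \<sigma> permutes {1..k}" using perm by (rule permutes_inv)
  have img': "(h \<circ> inv \<sigma>) ` {1..k} = P" unfolding image_comp[symmetric] permutes_image[OF inv] by (rule img)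
  have "ordered_parts n k id (h \<circ> inv \<sigma>)"
    unfolding ordered_parts_def
  proof (intro conjI ballI impI)
    show "\<Union> ((h \<circ> inv \<sigma>) ` {1..k}) = {1..n}" using img' P(1) by (simp add: partition_on_def)
    fix i j x y assume "i \<in> {1..k}" "j \<in> {1..k}" "id i < id j"
      "x \<in> (h \<circ> inv \<sigma>) i" "y \<in> (h \<circ> inv \<sigma>) j"
    then show "x < y"
      using ordered_partsD(5)[OF \<sigma>, of "inv \<sigma> i" "inv \<sigma> j" x y] permutes_in_image[OF inv]
        permutes_inverses(1)[OF perm] by simp
  next
    fix j assume "j \<in> {1..k}"
    then show "(h \<circ> inv \<sigma>) j \<noteq> {}"
      using ordered_partsD(2)[OF \<sigma>] permutes_in_image[OF inv] by simp
  qed (rule permutes_id)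
  with img' that show thesis by blast
qed

text \<open>Everything to the left of the part \<open>W j\<close> is filled by the parts with a smaller number, so the
  position of \<open>W j\<close> is determined by the sizes of these parts. It follows that \<open>\<sigma>\<close> and the sizes
  determine all parts, and the formula also serves to construct parts of prescribed sizes.\<close>

lemma ordered_part_eq:
  assumes W: "ordered_parts n k \<sigma> W" and j: "j \<in> {1..k}"
  defines "lo \<equiv> \<Sum>i | i \<in> {1..k} \<and> \<sigma> i < \<sigma> j. card (W i)"
  shows "W j = {Suc lo..lo + card (W j)}"
proof -
  obtain a b where ab: "W j = {a..b}"
    using consecutive_ordered_part[OF W j] unfolding consecutive_def by blast
  then have le: "a \<le> b" using ordered_partsD(2)[OF W j] by auto
  then have a: "1 \<le> a" "b \<le> n" using ordered_partsD(3)[OF W j] ab by auto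
  have "{1..<a} = (\<Union>i\<in>{i \<in> {1..k}. \<sigma> i < \<sigma> j}. W i)"
  proof
    show "{1..<a} \<subseteq> (\<Union>i\<in>{i \<in> {1..k}. \<sigma> i < \<sigma> j}. W i)"
    proof
      fix x assume x: "x \<in> {1..<a}"
      then obtain i where i: "i \<in> {1..k}" "x \<in> W i" using ordered_partsD(4)[OF W, of x] a le by auto
      have "i \<noteq> j" using i x ab by auto
      then have "\<sigma> i \<noteq> \<sigma> j" using ordered_partsD(1)[OF W] by (simp add: permutes_inj inj_eq)
      moreover have "\<sigma> i \<le> \<sigma> j" using ordered_partsD(6)[OF W i(1) j i(2), of a] ab le x by simp
      ultimately show "x \<in> (\<Union>i\<in>{i \<in> {1..k}. \<sigma> i < \<sigma> j}. W i)" using i by auto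
    qed
    show "(\<Union>i\<in>{i \<in> {1..k}. \<sigma> i < \<sigma> j}. W i) \<subseteq> {1..<a}"
    proof
      fix x assume "x \<in> (\<Union>i\<in>{i \<in> {1..k}. \<sigma> i < \<sigma> j}. W i)"
      then obtain i where i: "i \<in> {1..k}" "\<sigma> i < \<sigma> j" "x \<in> W i" by blast
      then have "x < a" using ordered_partsD(5)[OF W i(1) j i(2,3), of a] ab le by simp
      moreover have "x \<in> {1..n}" using ordered_partsD(3)[OF W i(1)] i by blast
      ultimately show "x \<in> {1..<a}" by simp
    qed
  qed
  then have "card {1..<a} = card (\<Union>i\<in>{i \<in> {1..k}. \<sigma> i < \<sigma> j}. W i)" by simp
  also have "\<dots> = lo"
    unfolding lo_def
  proof (rule card_UN_disjoint)
    show "\<forall>i\<in>{i \<in> {1..k}. \<sigma> i < \<sigma> j}. finite (W i)"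
      using consecutive_ordered_part[OF W] consecutive_iff by blast
    show "\<forall>i\<in>{i \<in> {1..k}. \<sigma> i < \<sigma> j}. \<forall>i'\<in>{i \<in> {1..k}. \<sigma> i < \<sigma> j}. i \<noteq> i' \<longrightarrow> W i \<inter> W i' = {}"
      using ordered_parts_disjoint[OF W] by blast
  qed simp
  finally have "a = Suc lo" using a by simp
  with ab le show ?thesis by simp
qed

lemma ordered_parts_unique:
  assumes "ordered_parts n k \<sigma> W" "ordered_parts n k \<sigma> W'"
    and card: "\<And>j. j \<in> {1..k} \<Longrightarrow> card (W j) = card (W' j)" and j: "j \<in> {1..k}"
  shows "W j = W' j"
proof -
  have "(\<Sum>i | i \<in> {1..k} \<and> \<sigma> i < \<sigma> j. card (W i)) = (\<Sum>i | i \<in> {1..k} \<and> \<sigma> i < \<sigma> j. card (W' i))"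
    using card by (intro sum.cong) auto
  then show ?thesis
    using ordered_part_eq[OF assms(1) j] ordered_part_eq[OF assms(2) j] card[OF j] by simp
qed

lemma ex_ordered_parts_cards:
  assumes \<sigma>: "\<sigma> permutes {1..k}" and pos: "\<And>j. j \<in> {1..k} \<Longrightarrow> c j > 0" and n: "(\<Sum>j\<in>{1..k}. c j) = n"
  obtains W where "ordered_parts n k \<sigma> W" "\<And>j. j \<in> {1..k} \<Longrightarrow> card (W j) = c j"
proof -
  define lo where "lo j = (\<Sum>i | i \<in> {1..k} \<and> \<sigma> i < \<sigma> j. c i)" for j
  define W where "W j = {Suc (lo j)..lo j + c j}" for j
  have step: "lo j + c j = (\<Sum>l\<in>insert j {l. l \<in> {1..k} \<and> \<sigma> l < \<sigma> j}. c l)" for j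
    unfolding lo_def by (subst sum.insert) auto
  have order: "x < y" if "i \<in> {1..k}" "j \<in> {1..k}" "\<sigma> i < \<sigma> j" "x \<in> W i" "y \<in> W j" for i j x y
  proof -
    have "lo i + c i \<le> lo j" unfolding step unfolding lo_def using that by (intro sum_mono2) auto
    with that show ?thesis by (simp add: W_def)
  qed
  have top: "lo j + c j \<le> n" if "j \<in> {1..k}" for j
    unfolding step n[symmetric] using that by (intro sum_mono2) auto
  have ne: "W j \<noteq> {}" if "j \<in> {1..k}" for j unfolding W_def using pos[OF that] by simp
  have disj: "W i \<inter> W j = {}" if "i \<in> {1..k}" "j \<in> {1..k}" "i \<noteq> j" for i j
  proof -
    have "\<sigma> i \<noteq> \<sigma> j" using that \<sigma> by (simp add: permutes_inj inj_eq)
    then have "\<sigma> i < \<sigma> j \<or> \<sigma> j < \<sigma> i" by linarith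
    then show ?thesis using order that by (metis disjoint_iff less_irrefl)
  qed
  have "card (\<Union>j\<in>{1..k}. W j) = (\<Sum>j\<in>{1..k}. card (W j))"
    using disj by (intro card_UN_disjoint) (auto simp: W_def)
  then have "card (\<Union>j\<in>{1..k}. W j) = n" using n by (simp add: W_def)
  moreover have "(\<Union>j\<in>{1..k}. W j) \<subseteq> {1..n}" using top unfolding W_def by fastforce
  ultimately have "(\<Union>j\<in>{1..k}. W j) = {1..n}" by (intro card_subset_eq) auto
  then have "ordered_parts n k \<sigma> W" unfolding ordered_parts_def using \<sigma> ne order by blast
  then show thesis using that by (simp add: W_def)
qed

section \<open>Permutations preserving a family of sets\<close>

text \<open>Permuting \<open>A \<union> B\<close> with \<open>A\<close> (and hence \<open>B\<close>) kept fixed as a set means permuting \<open>A\<close> and \<open>B\<close>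
  independently. It is used both for permutations inside blocks and for sum decompositions.\<close>

lemma bij_betw_permutes_disjoint_union:
  assumes "A \<inter> B = {}"
  shows "bij_betw (\<lambda>(\<alpha>, \<beta>). \<alpha> \<circ> \<beta>) ({\<alpha>. \<alpha> permutes A} \<times> {\<beta>. \<beta> permutes B})
           {\<pi>. \<pi> permutes (A \<union> B) \<and> \<pi> ` A = A}"
proof (rule bij_betw_byWitness[where f' = "\<lambda>\<pi>. (restrict_id \<pi> A, restrict_id \<pi> B)"])
  have eq: "restrict_id (\<alpha> \<circ> \<beta>) A = \<alpha> \<and> restrict_id (\<alpha> \<circ> \<beta>) B = \<beta>"
    if "\<alpha> permutes A" "\<beta> permutes B" for \<alpha> \<beta>
  proof (intro conjI ext)
    fix x
    have "x \<in> A \<Longrightarrow> \<beta> x = x" "x \<notin> A \<Longrightarrow> \<alpha> x = x" "x \<notin> B \<Longrightarrow> \<beta> x = x"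
      using assms that by (auto intro: permutes_not_in)
    moreover have "x \<in> B \<Longrightarrow> \<alpha> (\<beta> x) = \<beta> x"
      using assms that by (intro permutes_not_in[of \<alpha> A]) (auto simp: permutes_in_image)
    ultimately show "restrict_id (\<alpha> \<circ> \<beta>) A x = \<alpha> x" "restrict_id (\<alpha> \<circ> \<beta>) B x = \<beta> x"
      by (auto simp: restrict_id_def)
  qed
  then show "\<forall>a\<in>{\<alpha>. \<alpha> permutes A} \<times> {\<beta>. \<beta> permutes B}.
      (case case a of (\<alpha>, \<beta>) \<Rightarrow> \<alpha> \<circ> \<beta> of \<pi> \<Rightarrow> (restrict_id \<pi> A, restrict_id \<pi> B)) = a"
    by auto
  have image: "\<pi> ` A = A \<Longrightarrow> \<pi> permutes (A \<union> B) \<Longrightarrow> \<pi> ` B = B" for \<pi>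
  proof -
    assume \<pi>: "\<pi> ` A = A" "\<pi> permutes (A \<union> B)"
    have B: "(A \<union> B) - A = B" using assms by blast
    have "\<pi> ` ((A \<union> B) - A) = \<pi> ` (A \<union> B) - \<pi> ` A"
      using \<pi>(2) by (intro image_set_diff permutes_inj)
    then show "\<pi> ` B = B" unfolding permutes_image[OF \<pi>(2)] \<pi>(1) B .
  qed
  show "\<forall>\<pi>\<in>{\<pi>. \<pi> permutes (A \<union> B) \<and> \<pi> ` A = A}.
      (case (restrict_id \<pi> A, restrict_id \<pi> B) of (\<alpha>, \<beta>) \<Rightarrow> \<alpha> \<circ> \<beta>) = \<pi>"
  proof
    fix \<pi> assume "\<pi> \<in> {\<pi>. \<pi> permutes (A \<union> B) \<and> \<pi> ` A = A}"
    then have \<pi>: "\<pi> permutes (A \<union> B)" "\<pi> ` A = A" by auto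
    have "restrict_id \<pi> A (restrict_id \<pi> B x) = \<pi> x" for x
      using \<pi> image[OF \<pi>(2,1)] assms permutes_not_in[OF \<pi>(1), of x] by (auto simp: restrict_id_def)
    then show "(case (restrict_id \<pi> A, restrict_id \<pi> B) of (\<alpha>, \<beta>) \<Rightarrow> \<alpha> \<circ> \<beta>) = \<pi>" by (simp add: fun_eq_iff)
  qed
  show "(\<lambda>(\<alpha>, \<beta>). \<alpha> \<circ> \<beta>) ` ({\<alpha>. \<alpha> permutes A} \<times> {\<beta>. \<beta> permutes B})
      \<subseteq> {\<pi>. \<pi> permutes (A \<union> B) \<and> \<pi> ` A = A}"
  proof clarsimp
    fix \<alpha> \<beta> assume ab: "\<alpha> permutes A" "\<beta> permutes B"
    then have "\<alpha> permutes (A \<union> B)" "\<beta> permutes (A \<union> B)" by (auto intro: permutes_subset)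
    moreover have "\<beta> ` A = A"
    proof -
      have "\<beta> x = x" if "x \<in> A" for x using that ab assms by (auto intro: permutes_not_in)
      then show ?thesis by simp
    qed
    ultimately show "\<alpha> \<circ> \<beta> permutes A \<union> B \<and> (\<lambda>x. \<alpha> (\<beta> x)) ` A = A"
      using permutes_image[OF ab(1)] by (metis (no_types) image_image permutes_compose)
  qed
  show "(\<lambda>\<pi>. (restrict_id \<pi> A, restrict_id \<pi> B)) ` {\<pi>. \<pi> permutes (A \<union> B) \<and> \<pi> ` A = A}
      \<subseteq> {\<alpha>. \<alpha> permutes A} \<times> {\<beta>. \<beta> permutes B}"
  proof clarsimp
    fix \<pi> assume \<pi>: "\<pi> permutes (A \<union> B)" "\<pi> ` A = A"
    then show "restrict_id \<pi> A permutes A \<and> restrict_id \<pi> B permutes B"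
      using image[OF \<pi>(2,1)]
      by (intro conjI permutes_restrict_id bij_betw_imageI permutes_inj_on[OF \<pi>(1)])
  qed
qed

lemma card_permutes_preserving_family:
  assumes "finite K" "disjoint_family_on g K" "\<And>j. j \<in> K \<Longrightarrow> finite (g j)"
  shows "card {\<beta>. \<beta> permutes (\<Union>j\<in>K. g j) \<and> (\<forall>j\<in>K. \<beta> ` g j = g j)} = (\<Prod>j\<in>K. fact (card (g j)))"
  using assms
proof (induction K rule: finite_induct)
  case empty
  then show ?case by simp
next
  case (insert a K)
  define B where "B = (\<Union>j\<in>K. g j)"
  define S where "S = {\<beta>. \<beta> permutes B \<and> (\<forall>j\<in>K. \<beta> ` g j = g j)}"
  let ?f = "\<lambda>(\<alpha>, \<beta>). \<alpha> \<circ> (\<beta> :: 'b \<Rightarrow> 'b)"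
  have disj: "g a \<inter> B = {}"
  proof -
    have "g a \<inter> g j = {}" if "j \<in> K" for j
      using insert.hyps(2) that by (intro disjoint_family_onD[OF insert.prems(1)]) auto
    then show ?thesis unfolding B_def by blast
  qed
  note bij = bij_betw_permutes_disjoint_union[OF disj]
  have sub: "{\<alpha>. \<alpha> permutes g a} \<times> S \<subseteq> {\<alpha>. \<alpha> permutes g a} \<times> {\<beta>. \<beta> permutes B}"
    unfolding S_def by blast
  have img_j: "(\<alpha> \<circ> \<beta>) ` g j = \<beta> ` g j" if "\<alpha> permutes g a" "\<beta> permutes B" "j \<in> K" for \<alpha> \<beta> j
  proof -
    have "\<alpha> (\<beta> x) = \<beta> x" if "x \<in> g j" for x
    proof -
      have "\<beta> x \<in> B" using that \<open>j \<in> K\<close> permutes_in_image[OF \<open>\<beta> permutes B\<close>] unfolding B_def by blast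
      then show ?thesis using disj \<open>\<alpha> permutes g a\<close> by (auto intro: permutes_not_in)
    qed
    then have "(\<alpha> \<circ> \<beta>) ` g j = \<beta> ` g j" by (intro image_cong) simp_all
    then show ?thesis .
  qed
  have "?f ` ({\<alpha>. \<alpha> permutes g a} \<times> S)
      = {\<beta>. \<beta> permutes (\<Union>j\<in>insert a K. g j) \<and> (\<forall>j\<in>insert a K. \<beta> ` g j = g j)}" (is "?L = ?R")
  proof
    show "?L \<subseteq> ?R"
    proof
      fix \<pi> assume "\<pi> \<in> ?L"
      then obtain \<alpha> \<beta> where \<pi>: "\<pi> = \<alpha> \<circ> \<beta>" "\<alpha> permutes g a" "\<beta> \<in> S" by auto
      then have "\<pi> \<in> {\<pi>. \<pi> permutes (g a \<union> B) \<and> \<pi> ` g a = g a}"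
        using bij unfolding bij_betw_def S_def by blast
      moreover have "\<pi> ` g j = g j" if "j \<in> K" for j
        using img_j[of \<alpha> \<beta> j] \<pi> that unfolding S_def by auto
      ultimately show "\<pi> \<in> ?R" by (simp add: B_def)
    qed
    show "?R \<subseteq> ?L"
    proof
      fix \<pi> assume \<pi>: "\<pi> \<in> ?R"
      then have "\<pi> \<in> {\<pi>. \<pi> permutes (g a \<union> B) \<and> \<pi> ` g a = g a}" by (simp add: B_def)
      then have "\<pi> \<in> ?f ` ({\<alpha>. \<alpha> permutes g a} \<times> {\<beta>. \<beta> permutes B})"
        using bij unfolding bij_betw_def by blast
      then obtain \<alpha> \<beta> where ab: "\<pi> = \<alpha> \<circ> \<beta>" "\<alpha> permutes g a" "\<beta> permutes B" by auto
      then have "\<beta> ` g j = g j" if "j \<in> K" for j using img_j[OF ab(2,3) that] \<pi> that by simp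
      then have "\<beta> \<in> S" using ab unfolding S_def by blast
      then show "\<pi> \<in> ?L" using ab by auto
    qed
  qed
  moreover have "inj_on ?f ({\<alpha>. \<alpha> permutes g a} \<times> S)"
    using bij sub by (meson bij_betw_def inj_on_subset)
  then have "card (?f ` ({\<alpha>. \<alpha> permutes g a} \<times> S)) = card ({\<alpha>. \<alpha> permutes g a} \<times> S)"
    by (rule card_image)
  ultimately have "card ?R = card ({\<alpha>. \<alpha> permutes g a} \<times> S)" by (simp only:)
  also have "\<dots> = fact (card (g a)) * card S"
    using insert.prems(2) by (simp add: card_cartesian_product card_permutations)
  also have "card S = (\<Prod>j\<in>K. fact (card (g j)))"
    unfolding S_def B_def
  proof (rule insert.IH)
    show "disjoint_family_on g K" using insert.prems(1) by (rule disjoint_family_on_mono[rotated]) blast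
    show "finite (g j)" if "j \<in> K" for j using insert.prems(2) that by blast
  qed
  finally show ?case using insert.hyps by simp
qed

section \<open>Inflations of simple permutations\<close>

text \<open>The permutations that arise from \<open>\<sigma>\<close> by replacing its entry at \<open>j\<close> by a block on the positions \<open>g j\<close>:
  the value intervals \<open>\<pi> ` g j\<close> must be arranged as the entries of \<open>\<sigma>\<close>, while the pattern inside each
  block is free.\<close>

definition inflations :: "nat \<Rightarrow> nat \<Rightarrow> (nat \<Rightarrow> nat set) \<Rightarrow> (nat \<Rightarrow> nat) \<Rightarrow> (nat \<Rightarrow> nat) set" where
  "inflations n k g \<sigma> = {\<pi>. \<pi> permutes {1..n} \<and> ordered_parts n k \<sigma> (\<lambda>j. \<pi> ` g j)}"

text \<open>All inflations of \<open>\<sigma>\<close> with the same position blocks have the same value blocks, so they differ from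
  any one of them by a permutation that preserves every position block. There are
  \<open>fact (card (g j))\<close> choices inside each block.\<close>

lemma card_inflations:
  assumes g: "ordered_parts n k id g" and \<sigma>: "\<sigma> permutes {1..k}"
  shows "card (inflations n k g \<sigma>) = (\<Prod>j\<in>{1..k}. fact (card (g j)))"
proof -
  have fin: "finite (g j)" if "j \<in> {1..k}" for j
    using consecutive_ordered_part[OF g that] by (simp add: consecutive_iff)
  have pos: "card (g j) > 0" if "j \<in> {1..k}" for j
    using fin[OF that] ordered_partsD(2)[OF g that] by (simp add: card_gt_0_iff)
  have cover: "(\<Union>j\<in>{1..k}. g j) = {1..n}" using g unfolding ordered_parts_def by blast
  have "(\<Sum>j\<in>{1..k}. card (g j)) = card (\<Union>j\<in>{1..k}. g j)"
    using fin ordered_parts_disjoint[OF g] by (intro card_UN_disjoint[symmetric]) blast+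
  then have "(\<Sum>j\<in>{1..k}. card (g j)) = n" using cover by simp
  from ex_ordered_parts_cards[OF \<sigma> pos this]
  obtain W where W: "ordered_parts n k \<sigma> W" and cW: "\<And>j. j \<in> {1..k} \<Longrightarrow> card (W j) = card (g j)"
    by blast
  have finW: "finite (W j)" if "j \<in> {1..k}" for j
    using consecutive_ordered_part[OF W that] by (simp add: consecutive_iff)
  have coverW: "(\<Union>j\<in>{1..k}. W j) = {1..n}" using W unfolding ordered_parts_def by blast
  have mem: "\<pi> \<in> inflations n k g \<sigma> \<longleftrightarrow> \<pi> permutes {1..n} \<and> (\<forall>j\<in>{1..k}. \<pi> ` g j = W j)" for \<pi>
  proof
    assume "\<pi> \<in> inflations n k g \<sigma>"
    then have \<pi>: "\<pi> permutes {1..n}" "ordered_parts n k \<sigma> (\<lambda>j. \<pi> ` g j)" unfolding inflations_def by auto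
    have "card (\<pi> ` g j) = card (W j)" if "j \<in> {1..k}" for j
      using cW[OF that] card_image[OF permutes_inj_on[OF \<pi>(1)]] by metis
    from ordered_parts_unique[OF \<pi>(2) W this] \<pi>(1)
    show "\<pi> permutes {1..n} \<and> (\<forall>j\<in>{1..k}. \<pi> ` g j = W j)" by blast
  next
    assume *: "\<pi> permutes {1..n} \<and> (\<forall>j\<in>{1..k}. \<pi> ` g j = W j)"
    then have "ordered_parts n k \<sigma> (\<lambda>j. \<pi> ` g j)" by (intro ordered_parts_cong[OF W]) blast
    with * show "\<pi> \<in> inflations n k g \<sigma>" unfolding inflations_def by blast
  qed
  have "\<exists>h. bij_betw h (g j) (W j)" if "j \<in> {1..k}" for j
    using finite_same_card_bij[OF fin finW] cW that by auto
  then obtain h where h: "\<And>j. j \<in> {1..k} \<Longrightarrow> bij_betw (h j) (g j) (W j)" by metis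
  obtain q where q: "\<And>x. x \<in> {1..n} \<Longrightarrow> q x \<in> {1..k} \<and> x \<in> g (q x)"
    using ordered_partsD(4)[OF g] by metis
  \<comment> \<open>A particular inflation, glued from arbitrary bijections between corresponding parts.\<close>
  define \<pi>\<^sub>0 where "\<pi>\<^sub>0 x = (if x \<in> {1..n} then h (q x) x else x)" for x
  have "\<pi>\<^sub>0 x = h j x" if "j \<in> {1..k}" "x \<in> g j" for x j
  proof -
    have x: "x \<in> {1..n}" using ordered_partsD(3)[OF g] that by blast
    then have "q x = j" using q[OF x] ordered_parts_disjoint[OF g] that by blast
    with x show ?thesis by (simp add: \<pi>\<^sub>0_def)
  qed
  then have img: "\<pi>\<^sub>0 ` g j = W j" if "j \<in> {1..k}" for j
    using h[OF that] that unfolding bij_betw_def by (metis (no_types, lifting) image_cong)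
  have "\<pi>\<^sub>0 ` {1..n} = {1..n}"
  proof -
    have "\<pi>\<^sub>0 ` (\<Union>j\<in>{1..k}. g j) = (\<Union>j\<in>{1..k}. \<pi>\<^sub>0 ` g j)" by (rule image_UN)
    also have "\<dots> = (\<Union>j\<in>{1..k}. W j)" by (intro SUP_cong refl img)
    finally show ?thesis unfolding cover coverW .
  qed
  then have "bij_betw \<pi>\<^sub>0 {1..n} {1..n}" by (simp add: bij_betw_def eq_card_imp_inj_on)
  then have \<pi>\<^sub>0: "\<pi>\<^sub>0 permutes {1..n}" by (rule bij_imp_permutes) (simp only: \<pi>\<^sub>0_def if_False)
  let ?S = "{\<beta>. \<beta> permutes (\<Union>j\<in>{1..k}. g j) \<and> (\<forall>j\<in>{1..k}. \<beta> ` g j = g j)}"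
  have "inflations n k g \<sigma> = (\<circ>) \<pi>\<^sub>0 ` ?S"
  proof
    show "(\<circ>) \<pi>\<^sub>0 ` ?S \<subseteq> inflations n k g \<sigma>"
    proof
      fix \<pi> assume "\<pi> \<in> (\<circ>) \<pi>\<^sub>0 ` ?S"
      then obtain \<beta> where \<beta>: "\<pi> = \<pi>\<^sub>0 \<circ> \<beta>" "\<beta> permutes {1..n}" "\<And>j. j \<in> {1..k} \<Longrightarrow> \<beta> ` g j = g j"
        unfolding cover by blast
      have "\<pi> ` g j = W j" if "j \<in> {1..k}" for j
        unfolding \<beta>(1) image_comp[symmetric] \<beta>(3)[OF that] by (rule img[OF that])
      moreover have "\<pi> permutes {1..n}" unfolding \<beta>(1) by (rule permutes_compose[OF \<beta>(2) \<pi>\<^sub>0])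
      ultimately show "\<pi> \<in> inflations n k g \<sigma>" unfolding mem by blast
    qed
    show "inflations n k g \<sigma> \<subseteq> (\<circ>) \<pi>\<^sub>0 ` ?S"
    proof
      fix \<pi> assume "\<pi> \<in> inflations n k g \<sigma>"
      then have \<pi>: "\<pi> permutes {1..n}" "\<And>j. j \<in> {1..k} \<Longrightarrow> \<pi> ` g j = W j" unfolding mem by auto
      have "(inv \<pi>\<^sub>0 \<circ> \<pi>) ` g j = g j" if "j \<in> {1..k}" for j
      proof -
        have "(inv \<pi>\<^sub>0 \<circ> \<pi>) ` g j = inv \<pi>\<^sub>0 ` (\<pi>\<^sub>0 ` g j)"
          unfolding image_comp[symmetric] img[OF that] \<pi>(2)[OF that] ..
        then show ?thesis using permutes_inj[OF \<pi>\<^sub>0] by (simp add: image_inv_f_f)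
      qed
      moreover have "inv \<pi>\<^sub>0 \<circ> \<pi> permutes {1..n}"
        by (rule permutes_compose[OF \<pi>(1) permutes_inv[OF \<pi>\<^sub>0]])
      ultimately have "inv \<pi>\<^sub>0 \<circ> \<pi> \<in> ?S" unfolding cover by blast
      moreover have "\<pi> = \<pi>\<^sub>0 \<circ> (inv \<pi>\<^sub>0 \<circ> \<pi>)"
        by (simp add: fun_eq_iff permutes_inverses(1)[OF \<pi>\<^sub>0])
      ultimately show "\<pi> \<in> (\<circ>) \<pi>\<^sub>0 ` ?S" by blast
    qed
  qed
  moreover have "inj_on ((\<circ>) \<pi>\<^sub>0) ?S"
    using permutes_inj[OF \<pi>\<^sub>0] by (intro inj_onI) (simp add: fun_eq_iff inj_eq)
  ultimately have "card (inflations n k g \<sigma>) = card ?S" by (simp only: card_image)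
  also have "\<dots> = (\<Prod>j\<in>{1..k}. fact (card (g j)))"
    using ordered_parts_disjoint_family[OF g] fin by (intro card_permutes_preserving_family) auto
  finally show ?thesis .
qed

text \<open>If the first or the last entry of \<open>\<sigma>\<close> were the least or the greatest value, then the other entries
  would form a block. It has \<open>k - 1\<close> entries, so \<open>k \<ge> 3\<close> prevents it from being a singleton.\<close>

lemma simple_perm_endpoint:
  assumes \<sigma>: "simple_perm k \<sigma>" and k: "k \<ge> 3" and l: "l = 1 \<or> l = k"
  shows "1 < \<sigma> l" "\<sigma> l < k"
proof -
  have perm: "\<sigma> permutes {1..k}" using \<sigma> unfolding simple_perm_def by blast
  have remove: "consecutive ({1..k} - {m})" if "m = 1 \<or> m = k" for m
  proof -
    have "{1..k} - {1} = {2..k}" "{1..k} - {k} = {1..k - 1}" using k by auto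
    then show ?thesis using that by (metis consecutive_atLeastAtMost)
  qed
  let ?K = "{1..k} - {l}"
  have lk: "l \<in> {1..k}" using l k by auto
  have img: "\<sigma> ` ?K = {1..k} - {\<sigma> l}"
    using permutes_image[OF perm] permutes_inj[OF perm] by (simp add: image_set_diff)
  have "card ?K = k - 1" using lk by simp
  then have cardK: "card ?K \<noteq> 0" "card ?K \<noteq> 1" using k by simp_all
  then have "\<not> is_singleton ?K" unfolding is_singleton_altdef by blast
  moreover have "?K \<noteq> {}" using cardK(1) by (metis card.empty)
  moreover have "?K \<noteq> {1..k}" using lk by blast
  ultimately have "\<not> perm_block k \<sigma> ?K" using \<sigma> unfolding simple_perm_def by blast
  then have "\<not> consecutive ({1..k} - {\<sigma> l})"
    using remove[OF l] \<open>?K \<noteq> {}\<close> unfolding perm_block_def img by blast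
  then have "\<sigma> l \<noteq> 1" "\<sigma> l \<noteq> k" using remove by blast+
  moreover have "\<sigma> l \<in> {1..k}" using permutes_in_image[OF perm] lk by blast
  ultimately show "1 < \<sigma> l" "\<sigma> l < k" by auto
qed

text \<open>The parts that a block \<open>B\<close> meets correspond to a block of \<open>\<sigma>\<close>. If \<open>B\<close> meets a single part, it is
  contained in it. If it meets all of them, then it contains each part that lies between two others,
  by position or by value; since the entries of \<open>\<sigma>\<close> that are extreme in position are not extreme in
  value, no part is left over.\<close>

lemma inflation_block:
  assumes g: "ordered_parts n k id g" and \<sigma>: "simple_perm k \<sigma>" and k: "k \<ge> 3"
    and \<pi>: "\<pi> \<in> inflations n k g \<sigma>" and B: "perm_block n \<pi> B"
  shows "B = {1..n} \<or> (\<exists>j\<in>{1..k}. B \<subseteq> g j)"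
proof -
  have perm: "\<pi> permutes {1..n}" and W: "ordered_parts n k \<sigma> (\<lambda>j. \<pi> ` g j)"
    using \<pi> unfolding inflations_def by auto
  have B': "B \<noteq> {}" "B \<subseteq> {1..n}" "consecutive B" "consecutive (\<pi> ` B)"
    using B unfolding perm_block_def by auto
  have meet: "\<pi> ` g j \<inter> \<pi> ` B \<noteq> {} \<longleftrightarrow> g j \<inter> B \<noteq> {}" for j
    using permutes_inj[OF perm] by (simp flip: image_Int)
  define K where "K = {j \<in> {1..k}. g j \<inter> B \<noteq> {}}"
  have in_K: "\<exists>j\<in>K. x \<in> g j" if "x \<in> B" for x
    using ordered_partsD(4)[OF g, of x] that B' unfolding K_def by blast
  have "K \<noteq> {}" using in_K B' by blast
  moreover have "consecutive K"
    using consecutive_ordered_parts_meeting[OF g B'(3)] by (simp add: K_def)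
  moreover have "consecutive (\<sigma> ` K)"
    using consecutive_ordered_parts_meeting[OF W B'(4)] unfolding meet K_def .
  ultimately have "perm_block k \<sigma> K" unfolding perm_block_def K_def by blast
  then have "is_singleton K \<or> K = {1..k}" using \<sigma> unfolding simple_perm_def by blast
  then show ?thesis
  proof
    assume "is_singleton K"
    then obtain j where "K = {j}" by (rule is_singletonE)
    moreover from this have "j \<in> {1..k}" unfolding K_def by blast
    ultimately show ?thesis using in_K by blast
  next
    assume K: "K = {1..k}"
    then have touch: "g j \<inter> B \<noteq> {}" if "j \<in> {1..k}" for j using that unfolding K_def by blast
    have \<sigma>perm: "\<sigma> permutes {1..k}" using \<sigma> unfolding simple_perm_def by blast
    have ends: "1 \<in> {1..k}" "k \<in> {1..k}" using k by auto
    \<comment> \<open>The parts \<open>a\<close> and \<open>b\<close> carry the lowest and the highest values.\<close>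
    obtain a b where a: "a \<in> {1..k}" "\<sigma> a = 1" and b: "b \<in> {1..k}" "\<sigma> b = k"
      using ends permutes_image[OF \<sigma>perm] by (metis imageE)
    have "g l \<subseteq> B" if l: "l \<in> {1..k}" for l
    proof (cases "l = 1 \<or> l = k")
      case True
      note bounds = simple_perm_endpoint[OF \<sigma> k True]
      have "\<pi> ` g l \<subseteq> \<pi> ` B"
      proof (rule ordered_part_between[OF W B'(4) a(1) _ b(1) _ l])
        show "\<pi> ` g a \<inter> \<pi> ` B \<noteq> {}" "\<pi> ` g b \<inter> \<pi> ` B \<noteq> {}" unfolding meet using touch a b by auto
      qed (use bounds a b in auto)
      then show ?thesis using permutes_inj[OF perm] by (simp add: inj_image_subset_iff)
    next
      case False
      then have "id 1 < id l" "id l < id k" using l by auto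
      then show ?thesis
        using ordered_part_between[OF g B'(3) ends(1) touch[OF ends(1)] ends(2) touch[OF ends(2)] l] by blast
    qed
    then have "{1..n} \<subseteq> B" using ordered_partsD(4)[OF g] by blast
    then show ?thesis using B' by blast
  qed
qed

lemma ordered_parts_proper:
  assumes g: "ordered_parts n k \<sigma> g" and "k \<ge> 2" "j \<in> {1..k}"
  shows "g j \<noteq> {1..n}"
proof
  assume eq: "g j = {1..n}"
  have "\<exists>i\<in>{1..k}. i \<noteq> j" using assms(2) by (intro bexI[of _ "if j = 1 then 2 else 1"]) auto
  then obtain i where i: "i \<in> {1..k}" "i \<noteq> j" by blast
  then obtain x where "x \<in> g i" using ordered_partsD(2)[OF g] by blast
  then have "x \<in> g j" using eq ordered_partsD(3)[OF g i(1)] by blast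
  then show False using ordered_parts_disjoint[OF g i(1) assms(3) \<open>x \<in> g i\<close>] i by blast
qed

text \<open>Two complementary blocks would each be contained in one part, which leaves no room for a third part.\<close>

lemma inflation_not_decomposable:
  assumes g: "ordered_parts n k id g" and \<sigma>: "simple_perm k \<sigma>" and k: "k \<ge> 3"
    and \<pi>: "\<pi> \<in> inflations n k g \<sigma>"
  shows "\<not> decomposable n \<pi>"
proof
  assume "decomposable n \<pi>"
  then obtain A where A: "perm_block n \<pi> A" "perm_block n \<pi> ({1..n} - A)"
    unfolding decomposable_def by blast
  then have "A \<noteq> {1..n}" "{1..n} - A \<noteq> {1..n}" unfolding perm_block_def by auto
  then obtain i j where i: "i \<in> {1..k}" "A \<subseteq> g i" and j: "j \<in> {1..k}" "{1..n} - A \<subseteq> g j"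
    using inflation_block[OF g \<sigma> k \<pi> A(1)] inflation_block[OF g \<sigma> k \<pi> A(2)] by blast
  have "card {i, j} < card {1..k}" using k by (auto simp: card_insert_if)
  then obtain l where l: "l \<in> {1..k}" "l \<noteq> i" "l \<noteq> j"
    using i j by (metis card_mono finite.emptyI finite_insert insertCI leD subsetI)
  obtain x where x: "x \<in> g l" using ordered_partsD(2)[OF g l(1)] by blast
  then have "x \<in> g i \<or> x \<in> g j" using ordered_partsD(3)[OF g l(1)] i j by blast
  then show False using ordered_parts_disjoint[OF g l(1) _ x] i j l by blast
qed

lemma inflation_maximal_blocks:
  assumes g: "ordered_parts n k id g" and \<sigma>: "simple_perm k \<sigma>" and k: "k \<ge> 3"
    and \<pi>: "\<pi> \<in> inflations n k g \<sigma>"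
  shows "maximal_blocks n \<pi> = g ` {1..k}"
proof -
  have W: "ordered_parts n k \<sigma> (\<lambda>j. \<pi> ` g j)" using \<pi> unfolding inflations_def by auto
  have proper: "proper_block n \<pi> (g j)" if "j \<in> {1..k}" for j
    using consecutive_ordered_part[OF g that] consecutive_ordered_part[OF W that]
      ordered_partsD(2,3)[OF g that] ordered_parts_proper[OF g _ that] k
    unfolding proper_block_def perm_block_def by auto
  have below: "\<exists>j\<in>{1..k}. B \<subseteq> g j" if "proper_block n \<pi> B" for B
    using inflation_block[OF g \<sigma> k \<pi>, of B] that unfolding proper_block_def by blast
  show ?thesis
  proof
    show "maximal_blocks n \<pi> \<subseteq> g ` {1..k}"
    proof
      fix B assume B: "B \<in> maximal_blocks n \<pi>"
      then have "proper_block n \<pi> B" unfolding maximal_blocks_def by blast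
      from below[OF this] obtain j where "j \<in> {1..k}" "B \<subseteq> g j" by blast
      with B proper[of j] have "g j = B" unfolding maximal_blocks_def by blast
      with \<open>j \<in> {1..k}\<close> show "B \<in> g ` {1..k}" by blast
    qed
    show "g ` {1..k} \<subseteq> maximal_blocks n \<pi>"
    proof
      fix A assume "A \<in> g ` {1..k}"
      then obtain j where j: "j \<in> {1..k}" "A = g j" by blast
      have "B = g j" if B: "proper_block n \<pi> B" "g j \<subseteq> B" for B
      proof -
        obtain i where i: "i \<in> {1..k}" "B \<subseteq> g i" using below[OF B(1)] by blast
        obtain x where "x \<in> g j" using ordered_partsD(2)[OF g j(1)] by blast
        then have "i = j" using ordered_parts_disjoint[OF g i(1) j(1), of x] i B by blast
        then show ?thesis using i B by blast
      qed
      then show "A \<in> maximal_blocks n \<pi>" using proper j unfolding maximal_blocks_def by blast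
    qed
  qed
qed

text \<open>A block of the quotient gives a union of parts that is a block of \<open>\<pi>\<close>. If it misses a part, then it is
  proper and therefore, by maximality, no larger than a single part.\<close>

lemma ex_simple_quotient:
  assumes g: "ordered_parts n k id g" and \<pi>: "\<pi> permutes {1..n}"
    and max: "maximal_blocks n \<pi> = g ` {1..k}"
  shows "\<exists>\<sigma>. simple_perm k \<sigma> \<and> \<pi> \<in> inflations n k g \<sigma>"
proof -
  have block: "perm_block n \<pi> (g j)" if "j \<in> {1..k}" for j
  proof -
    have "g j \<in> maximal_blocks n \<pi>" using max that by blast
    then show ?thesis unfolding maximal_blocks_def proper_block_def by blast
  qed
  have "\<exists>\<sigma>. ordered_parts n k \<sigma> (\<lambda>j. \<pi> ` g j)"
  proof (rule ex_ordered_parts)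
    show "consecutive (\<pi> ` g j)" "\<pi> ` g j \<noteq> {}" if "j \<in> {1..k}" for j
      using block[OF that] unfolding perm_block_def by auto
    show "disjoint_family_on (\<lambda>j. \<pi> ` g j) {1..k}"
      using disjoint_family_onD[OF ordered_parts_disjoint_family[OF g]] permutes_inj[OF \<pi>]
      unfolding disjoint_family_on_def by (simp flip: image_Int)
    have "(\<Union>j\<in>{1..k}. g j) = {1..n}" using g unfolding ordered_parts_def by blast
    then show "(\<Union>j\<in>{1..k}. \<pi> ` g j) = {1..n}"
      using permutes_image[OF \<pi>] by (metis image_UN)
  qed
  then obtain \<sigma> where W: "ordered_parts n k \<sigma> (\<lambda>j. \<pi> ` g j)" by blast
  have "is_singleton K \<or> K = {1..k}" if K: "perm_block k \<sigma> K" for K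
  proof (cases "K = {1..k}")
    case False
    have K': "K \<noteq> {}" "K \<subseteq> {1..k}" "consecutive K" "consecutive (\<sigma> ` K)"
      using K unfolding perm_block_def by auto
    let ?B = "\<Union>j\<in>K. g j"
    obtain j where j: "j \<in> K" using K' by blast
    obtain l where l: "l \<in> {1..k}" "l \<notin> K" using False K' by blast
    obtain x where x: "x \<in> g l" using ordered_partsD(2)[OF g l(1)] by blast
    have "x \<in> {1..n}" using x ordered_partsD(3)[OF g l(1)] by blast
    moreover have "x \<notin> ?B" using ordered_parts_disjoint[OF g l(1) _ x] l K' by blast
    ultimately have "?B \<noteq> {1..n}" by blast
    moreover have "consecutive ?B" using consecutive_UN_ordered_parts[OF g K'(2)] K'(3) by simp
    moreover have "consecutive (\<pi> ` ?B)"
      using consecutive_UN_ordered_parts[OF W K'(2,4)] by (simp add: image_UN)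
    moreover have "?B \<noteq> {}"
    proof -
      have "g j \<noteq> {}" using j K'(2) by (intro ordered_partsD(2)[OF g]) blast
      then show ?thesis using j by blast
    qed
    moreover have "?B \<subseteq> {1..n}"
      using K'(2) by (intro UN_least ordered_partsD(3)[OF g]) blast
    ultimately have "proper_block n \<pi> ?B" unfolding proper_block_def perm_block_def by blast
    moreover have "g j \<in> maximal_blocks n \<pi>" "g j \<subseteq> ?B" using max j K' by blast+
    ultimately have B: "?B = g j" unfolding maximal_blocks_def by blast
    have "i = j" if i: "i \<in> K" for i
    proof -
      have ij: "i \<in> {1..k}" "j \<in> {1..k}" using i j K' by blast+
      obtain y where "y \<in> g i" using ordered_partsD(2)[OF g ij(1)] by blast
      moreover from this have "y \<in> g j" using B i by blast
      ultimately show ?thesis by (rule ordered_parts_disjoint[OF g ij])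
    qed
    then have "K = {j}" using j by blast
    then show ?thesis by simp
  qed simp
  then have "simple_perm k \<sigma>" using ordered_partsD(1)[OF W] unfolding simple_perm_def by blast
  then show ?thesis using W \<pi> unfolding inflations_def by blast
qed

text \<open>For a given partition into maximal blocks, the simple quotient and the patterns inside the blocks
  can be chosen freely and are determined by the permutation.\<close>

lemma card_maximal_blocks_eq:
  assumes P: "P \<in> interval_partitions n k" and k: "k \<ge> 3"
  shows "card {\<pi>. \<pi> permutes {1..n} \<and> \<not> decomposable n \<pi> \<and> maximal_blocks n \<pi> = P}
       = num_simple k * (\<Prod>B\<in>P. fact (card B))"
proof -
  obtain g where img: "g ` {1..k} = P" and g: "ordered_parts n k id g"
    using P by (rule ex_enumeration_interval_partition)
  have "{\<pi>. \<pi> permutes {1..n} \<and> \<not> decomposable n \<pi> \<and> maximal_blocks n \<pi> = P}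
      = (\<Union>\<sigma>\<in>{\<sigma>. simple_perm k \<sigma>}. inflations n k g \<sigma>)" (is "?L = ?R")
  proof
    show "?L \<subseteq> ?R"
    proof
      fix \<pi> assume "\<pi> \<in> ?L"
      then have "\<pi> permutes {1..n}" "maximal_blocks n \<pi> = g ` {1..k}" using img by simp_all
      from ex_simple_quotient[OF g this] show "\<pi> \<in> ?R" by blast
    qed
    show "?R \<subseteq> ?L"
    proof
      fix \<pi> assume "\<pi> \<in> ?R"
      then obtain \<sigma> where \<sigma>: "simple_perm k \<sigma>" "\<pi> \<in> inflations n k g \<sigma>" by blast
      then have "\<pi> permutes {1..n}" unfolding inflations_def by blast
      then show "\<pi> \<in> ?L"
        using inflation_not_decomposable[OF g \<sigma>(1) k \<sigma>(2)] inflation_maximal_blocks[OF g \<sigma>(1) k \<sigma>(2)] img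
        by simp
    qed
  qed
  moreover have "card ?R = (\<Sum>\<sigma>\<in>{\<sigma>. simple_perm k \<sigma>}. card (inflations n k g \<sigma>))"
  proof (rule card_UN_disjoint)
    have "{\<sigma>. simple_perm k \<sigma>} \<subseteq> {\<sigma>. \<sigma> permutes {1..k}}" unfolding simple_perm_def by blast
    then show "finite {\<sigma>. simple_perm k \<sigma>}" by (rule finite_subset) (simp add: finite_permutations)
    have "inflations n k g \<sigma> \<subseteq> {\<pi>. \<pi> permutes {1..n}}" for \<sigma> unfolding inflations_def by blast
    then show "\<forall>\<sigma>\<in>{\<sigma>. simple_perm k \<sigma>}. finite (inflations n k g \<sigma>)"
      using finite_permutations[of "{1..n}"] finite_subset by blast
    show "\<forall>\<sigma>\<in>{\<sigma>. simple_perm k \<sigma>}. \<forall>\<tau>\<in>{\<sigma>. simple_perm k \<sigma>}. \<sigma> \<noteq> \<tau> \<longrightarrow>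
        inflations n k g \<sigma> \<inter> inflations n k g \<tau> = {}"
      using ordered_parts_order_unique unfolding inflations_def by blast
  qed
  moreover have "card (inflations n k g \<sigma>) = (\<Prod>B\<in>P. fact (card B))" if "simple_perm k \<sigma>" for \<sigma>
    unfolding img[symmetric] prod.reindex[OF ordered_parts_inj[OF g]]
    using card_inflations[OF g] that unfolding simple_perm_def by simp
  ultimately show ?thesis by (simp add: num_simple_def)
qed

lemma card_indecomposable:
  assumes "n \<ge> 2"
  shows "card {\<pi>. \<pi> permutes {1..n} \<and> \<not> decomposable n \<pi>}
       = (\<Sum>k=3..n. num_simple k * (\<Sum>P\<in>interval_partitions n k. \<Prod>B\<in>P. fact (card B)))"
proof -
  define X where "X P = {\<pi>. \<pi> permutes {1..n} \<and> \<not> decomposable n \<pi> \<and> maximal_blocks n \<pi> = P}" for P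
  have finX: "finite (X P)" for P
    by (rule finite_subset[OF _ finite_permutations[of "{1..n}"]]) (auto simp: X_def)
  have mem: "maximal_blocks n \<pi> \<in> interval_partitions n (card (maximal_blocks n \<pi>))"
       "card (maximal_blocks n \<pi>) \<in> {3..n}"
    if \<pi>: "\<pi> permutes {1..n}" "\<not> decomposable n \<pi>" for \<pi>
  proof -
    have part: "partition_on {1..n} (maximal_blocks n \<pi>)"
      using \<pi> assms by (rule partition_on_maximal_blocks)
    then show P: "maximal_blocks n \<pi> \<in> interval_partitions n (card (maximal_blocks n \<pi>))"
      unfolding interval_partitions_def maximal_blocks_def proper_block_def perm_block_def by blast
    let ?P = "maximal_blocks n \<pi>"
    have fin: "finite B" "B \<noteq> {}" if "B \<in> ?P" for B
      using that unfolding maximal_blocks_def proper_block_def perm_block_def consecutive_iff by auto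
    have "card ?P = (\<Sum>B\<in>?P. 1)" by simp
    also have "\<dots> \<le> (\<Sum>B\<in>?P. card B)" using fin by (intro sum_mono) (simp add: Suc_le_eq card_gt_0_iff)
    also have "\<dots> = n" using product_partition[OF part fin(1)] by simp
    finally have "card ?P \<le> n" .
    then show "card ?P \<in> {3..n}" using card_maximal_blocks[OF \<pi> assms] by simp
  qed
  have "{\<pi>. \<pi> permutes {1..n} \<and> \<not> decomposable n \<pi>}
      = (\<Union>k\<in>{3..n}. \<Union>P\<in>interval_partitions n k. X P)"
    using mem unfolding X_def by blast
  also have "card \<dots> = (\<Sum>k=3..n. card (\<Union>P\<in>interval_partitions n k. X P))"
  proof (rule card_UN_disjoint)
    show "\<forall>k\<in>{3..n}. \<forall>l\<in>{3..n}. k \<noteq> l \<longrightarrow>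
        (\<Union>P\<in>interval_partitions n k. X P) \<inter> (\<Union>P\<in>interval_partitions n l. X P) = {}"
      unfolding X_def interval_partitions_def by blast
  qed (use finX finite_interval_partitions in auto)
  also have "\<dots> = (\<Sum>k=3..n. \<Sum>P\<in>interval_partitions n k. card (X P))"
  proof (intro sum.cong refl card_UN_disjoint)
    show "\<forall>P\<in>interval_partitions n k. \<forall>Q\<in>interval_partitions n k. P \<noteq> Q \<longrightarrow> X P \<inter> X Q = {}" for k
      unfolding X_def by blast
  qed (use finX finite_interval_partitions in auto)
  also have "\<dots> = (\<Sum>k=3..n. num_simple k * (\<Sum>P\<in>interval_partitions n k. \<Prod>B\<in>P. fact (card B)))"
    unfolding sum_distrib_left X_def using card_maximal_blocks_eq by (intro sum.cong) auto
  finally show ?thesis .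
qed

section \<open>Interval partitions and powers of the factorial series\<close>

unbundle fps_syntax

definition fact_fps :: "int fps" where
  "fact_fps = Abs_fps (\<lambda>n. if n = 0 then 0 else fact n)"

lemma interval_partitions_0: "interval_partitions n 0 = (if n = 0 then {{}} else {})"
proof -
  have "P = {} \<and> n = 0" if "P \<in> interval_partitions n 0" for P
  proof -
    have P: "partition_on {1..n} P" "card P = 0" using that unfolding interval_partitions_def by auto
    then have "finite P" using finite_elements[OF _ P(1)] by simp
    then show ?thesis using P by (auto simp: partition_on_def)
  qed
  moreover have "{} \<in> interval_partitions 0 0" by (simp add: interval_partitions_def partition_on_def)
  ultimately show ?thesis by auto
qed

text \<open>Splitting off the part \<open>{Suc m..n}\<close> that contains \<open>n\<close> mirrors the recursion for the coefficients of a
  power of a power series.\<close>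

lemma interval_partitions_Suc:
  "interval_partitions n (Suc k) = (\<Union>m\<in>{..<n}. insert {Suc m..n} ` interval_partitions m k)"
proof
  show "interval_partitions n (Suc k) \<subseteq> (\<Union>m\<in>{..<n}. insert {Suc m..n} ` interval_partitions m k)"
  proof
    fix Q assume "Q \<in> interval_partitions n (Suc k)"
    then have part: "partition_on {1..n} Q" and cons: "\<And>B. B \<in> Q \<Longrightarrow> consecutive B" and card: "card Q = Suc k"
      unfolding interval_partitions_def by auto
    have fin: "finite Q" using finite_elements[OF _ part] by simp
    have "n \<ge> 1"
    proof (rule ccontr)
      assume "\<not> n \<ge> 1"
      then have "Q = {}" using part by (simp add: partition_on_empty)
      then show False using card by simp
    qed
    then have "n \<in> \<Union>Q" unfolding partition_onD1[OF part, symmetric] by simp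
    then obtain B where B: "B \<in> Q" "n \<in> B" by blast
    obtain a b where ab: "B = {a..b}" using cons[OF B(1)] unfolding consecutive_def by blast
    have "B \<subseteq> {1..n}" using part B unfolding partition_on_def by blast
    then have "b = n" "1 \<le> a" "a \<le> n" using B ab by auto
    then have Beq: "B = {Suc (a - 1)..n}" "a - 1 < n" using ab by auto
    let ?P = "Q - {B}"
    have Q: "Q = insert B ?P" using B by blast
    have "disjnt B (\<Union>?P)"
    proof -
      have "B \<inter> C = {}" if "C \<in> ?P" for C
        using disjointD[OF partition_onD2[OF part] B(1), of C] that by blast
      then show ?thesis unfolding disjnt_def by blast
    qed
    then have "partition_on ({1..n} - B) ?P"
      using partition_on_insert[of B ?P "{1..n}"] part Q by simp
    moreover have "{1..n} - B = {1..a - 1}" unfolding Beq using \<open>a \<le> n\<close> by auto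
    ultimately have "?P \<in> interval_partitions (a - 1) k"
      using cons card B fin unfolding interval_partitions_def by simp
    then show "Q \<in> (\<Union>m\<in>{..<n}. insert {Suc m..n} ` interval_partitions m k)"
      using Q Beq by blast
  qed
  show "(\<Union>m\<in>{..<n}. insert {Suc m..n} ` interval_partitions m k) \<subseteq> interval_partitions n (Suc k)"
  proof
    fix Q assume "Q \<in> (\<Union>m\<in>{..<n}. insert {Suc m..n} ` interval_partitions m k)"
    then obtain m P where m: "m < n" and P: "P \<in> interval_partitions m k" and Q: "Q = insert {Suc m..n} P" by blast
    have part: "partition_on {1..m} P" and cons: "\<forall>B\<in>P. consecutive B" and card: "card P = k"
      using P unfolding interval_partitions_def by auto
    have U: "\<Union>P = {1..m}" using part unfolding partition_on_def by blast
    have fin: "finite P" using finite_elements[OF _ part] by simp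
    have "{1..n} - {Suc m..n} = {1..m}" using m by auto
    then have "partition_on {1..n} Q"
      unfolding Q using m part partition_on_insert[of "{Suc m..n}" P "{1..n}"]
      by (simp add: U disjnt_def)
    moreover have "{Suc m..n} \<notin> P"
    proof
      assume "{Suc m..n} \<in> P"
      then have "{Suc m..n} \<subseteq> {1..m}" using U by blast
      then show False using m by auto
    qed
    then have "card Q = Suc k" unfolding Q using fin card by simp
    ultimately show "Q \<in> interval_partitions n (Suc k)"
      using cons unfolding interval_partitions_def Q by simp
  qed
qed

lemma sum_interval_partitions:
  "int (\<Sum>P\<in>interval_partitions n k. \<Prod>B\<in>P. fact (card B)) = (fact_fps ^ k) $ n"
proof (induction k arbitrary: n)
  case 0
  show ?case by (simp add: interval_partitions_0)
next
  case (Suc k)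
  let ?w = "\<lambda>P :: nat set set. \<Prod>B\<in>P. fact (card B) :: nat"
  have below: "B \<subseteq> {1..m}" if "P \<in> interval_partitions m k" "B \<in> P" for P B m
    using that unfolding interval_partitions_def partition_on_def by blast
  have new: "{Suc m..n} \<notin> P" if "P \<in> interval_partitions m k" "m < n" for P m
    using below[OF that(1), of "{Suc m..n}"] that(2) by auto
  have "(\<Sum>P\<in>interval_partitions n (Suc k). ?w P)
      = (\<Sum>m<n. \<Sum>Q\<in>insert {Suc m..n} ` interval_partitions m k. ?w Q)"
    unfolding interval_partitions_Suc
  proof (rule sum.UNION_disjoint)
    have last: "B = {Suc m..n}" if "P \<in> interval_partitions m k" "B \<in> insert {Suc m..n} P" "n \<in> B" "m < n" for P B m
      using below[OF that(1)] that(2-4) by fastforce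
    show "\<forall>m\<in>{..<n}. \<forall>l\<in>{..<n}. m \<noteq> l \<longrightarrow>
        insert {Suc m..n} ` interval_partitions m k \<inter> insert {Suc l..n} ` interval_partitions l k = {}"
    proof (intro ballI impI, rule ccontr)
      fix m l assume ml: "m \<in> {..<n}" "l \<in> {..<n}" "m \<noteq> l"
        "insert {Suc m..n} ` interval_partitions m k \<inter> insert {Suc l..n} ` interval_partitions l k \<noteq> {}"
      then obtain P Q where PQ: "P \<in> interval_partitions l k" "insert {Suc m..n} Q = insert {Suc l..n} P" by blast
      then have "{Suc m..n} \<in> insert {Suc l..n} P" by blast
      then have "{Suc m..n} = {Suc l..n}" using last[OF PQ(1), of "{Suc m..n}"] ml by auto
      then show False using ml by (simp add: Icc_eq_Icc)
    qed
  qed (simp_all add: finite_interval_partitions)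
  also have "\<dots> = (\<Sum>m<n. \<Sum>P\<in>interval_partitions m k. ?w (insert {Suc m..n} P))"
  proof (rule sum.cong[OF refl])
    fix m assume m: "m \<in> {..<n}"
    have "inj_on (insert {Suc m..n}) (interval_partitions m k)"
    proof (rule inj_onI)
      fix P Q assume "P \<in> interval_partitions m k" "Q \<in> interval_partitions m k"
        "insert {Suc m..n} P = insert {Suc m..n} Q"
      then show "P = Q" using new m by (metis insert_ident lessThan_iff)
    qed
    then show "(\<Sum>Q\<in>insert {Suc m..n} ` interval_partitions m k. ?w Q)
        = (\<Sum>P\<in>interval_partitions m k. ?w (insert {Suc m..n} P))"
      by (rule sum.reindex[unfolded o_def])
  qed
  also have "\<dots> = (\<Sum>m<n. fact (n - m) * (\<Sum>P\<in>interval_partitions m k. ?w P))"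
    unfolding sum_distrib_left
  proof (intro sum.cong refl)
    fix m P assume m: "m \<in> {..<n}" and P: "P \<in> interval_partitions m k"
    have "finite P"
      using P finite_elements[of "{1..m}" P] unfolding interval_partitions_def by simp
    then show "?w (insert {Suc m..n} P) = fact (n - m) * ?w P"
      using new[OF P] m by simp
  qed
  finally have "int (\<Sum>P\<in>interval_partitions n (Suc k). ?w P)
      = (\<Sum>m<n. fact (n - m) * int (\<Sum>P\<in>interval_partitions m k. ?w P))"
    by (simp only: of_nat_sum of_nat_mult of_nat_fact)
  also have "\<dots> = (\<Sum>m<n. (fact_fps ^ k) $ m * fact_fps $ (n - m))"
    unfolding Suc.IH by (intro sum.cong refl) (auto simp: fact_fps_def)
  also have "\<dots> = (\<Sum>m=0..n. (fact_fps ^ k) $ m * fact_fps $ (n - m))"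
    by (intro sum.mono_neutral_left) (auto simp: fact_fps_def)
  also have "\<dots> = (fact_fps ^ Suc k) $ n"
    unfolding power_Suc2 fps_mult_nth ..
  finally show ?case .
qed

section \<open>Counting decomposable permutations\<close>

definition num_sum_decomposable :: "nat \<Rightarrow> nat" where
  "num_sum_decomposable n = card {\<pi>. \<pi> permutes {1..n} \<and> sum_decomposable n \<pi>}"

text \<open>If \<open>m\<close> is the least position at which \<open>\<pi>\<close> splits, then \<open>\<pi>\<close> is a sum whose first summand has length
  \<open>m\<close> and is itself not a sum; the second summand is arbitrary.\<close>

lemma card_permutes_first_component:
  assumes m: "0 < m" "m < n"
  shows "int (card {\<pi>. \<pi> permutes {1..n} \<and> \<pi> ` {1..m} = {1..m} \<and> (\<forall>l. 0 < l \<and> l < m \<longrightarrow> \<pi> ` {1..l} \<noteq> {1..l})})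
       = (fact m - int (num_sum_decomposable m)) * fact (n - m)"
    (is "int (card ?T) = _")
proof -
  let ?A = "{\<alpha>. \<alpha> permutes {1..m} \<and> \<not> sum_decomposable m \<alpha>}" and ?B = "{\<beta>. \<beta> permutes {Suc m..n}}"
  let ?f = "\<lambda>(\<alpha>, \<beta>). \<alpha> \<circ> (\<beta> :: nat \<Rightarrow> nat)"
  have disj: "{1..m} \<inter> {Suc m..n} = {}" by auto
  have un: "{1..m} \<union> {Suc m..n} = {1..n}" using m by auto
  note bij = bij_betw_permutes_disjoint_union[OF disj, unfolded un]
  have img: "(\<alpha> \<circ> \<beta>) ` {1..l} = \<alpha> ` {1..l}" if "\<beta> permutes {Suc m..n}" "l < m" for \<alpha> \<beta> l
  proof (intro image_cong refl)
    fix x assume "x \<in> {1..l}"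
    then have "\<beta> x = x" using that by (intro permutes_not_in[OF that(1)]) auto
    then show "(\<alpha> \<circ> \<beta>) x = \<alpha> x" by simp
  qed
  have "?f ` (?A \<times> ?B) = ?T"
  proof
    show "?f ` (?A \<times> ?B) \<subseteq> ?T"
    proof
      fix \<pi> assume "\<pi> \<in> ?f ` (?A \<times> ?B)"
      then obtain \<alpha> \<beta> where \<pi>: "\<pi> = \<alpha> \<circ> \<beta>" "\<alpha> permutes {1..m}" "\<not> sum_decomposable m \<alpha>" "\<beta> permutes {Suc m..n}" by auto
      then have "\<pi> \<in> {\<pi>. \<pi> permutes {1..n} \<and> \<pi> ` {1..m} = {1..m}}" using bij unfolding bij_betw_def by blast
      moreover have "\<pi> ` {1..l} \<noteq> {1..l}" if "0 < l" "l < m" for l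
        unfolding \<pi>(1) img[OF \<pi>(4) that(2)] using \<pi>(3) that unfolding sum_decomposable_def by blast
      ultimately show "\<pi> \<in> ?T" by blast
    qed
    show "?T \<subseteq> ?f ` (?A \<times> ?B)"
    proof
      fix \<pi> assume \<pi>: "\<pi> \<in> ?T"
      then have "\<pi> \<in> ?f ` ({\<alpha>. \<alpha> permutes {1..m}} \<times> ?B)" using bij unfolding bij_betw_def by blast
      then obtain \<alpha> \<beta> where ab: "\<pi> = \<alpha> \<circ> \<beta>" "\<alpha> permutes {1..m}" "\<beta> permutes {Suc m..n}" by auto
      have "\<not> sum_decomposable m \<alpha>"
      proof
        assume "sum_decomposable m \<alpha>"
        then obtain l where l: "0 < l" "l < m" "\<alpha> ` {1..l} = {1..l}" unfolding sum_decomposable_def by blast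
        then have "\<pi> ` {1..l} = {1..l}" unfolding ab(1) img[OF ab(3) l(2)] by simp
        then show False using \<pi> l by blast
      qed
      then show "\<pi> \<in> ?f ` (?A \<times> ?B)" using ab by auto
    qed
  qed
  moreover have "inj_on ?f (?A \<times> ?B)" using bij unfolding bij_betw_def by (rule inj_on_subset[OF conjunct1]) auto
  then have "card (?f ` (?A \<times> ?B)) = card (?A \<times> ?B)" by (rule card_image)
  ultimately have "card ?T = card ?A * card ?B" by (simp only: card_cartesian_product)
  also have "card ?B = fact (n - m)" by (simp add: card_permutations[OF refl])
  also have "card ?A = card ({\<alpha>. \<alpha> permutes {1..m}} - {\<alpha>. \<alpha> permutes {1..m} \<and> sum_decomposable m \<alpha>})"
    by (intro arg_cong[where f = card]) blast
  also have "int (\<dots> * fact (n - m)) = (fact m - int (num_sum_decomposable m)) * fact (n - m)"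
  proof -
    have fin: "finite {\<alpha>. \<alpha> permutes {1..m}}" by (simp add: finite_permutations)
    have "card {\<alpha>. \<alpha> permutes {1..m}} = fact m" by (simp add: card_permutations[OF refl])
    moreover have "{\<alpha>. \<alpha> permutes {1..m} \<and> sum_decomposable m \<alpha>} \<subseteq> {\<alpha>. \<alpha> permutes {1..m}}" by blast
    ultimately show ?thesis
      using card_mono[OF fin] fin
      by (simp add: card_Diff_subset finite_subset of_nat_diff num_sum_decomposable_def)
  qed
  finally show ?thesis .
qed

lemma num_sum_decomposable_rec:
  "int (num_sum_decomposable n) = (\<Sum>m=1..<n. (fact m - int (num_sum_decomposable m)) * fact (n - m))"
proof -
  define T where "T m = {\<pi>. \<pi> permutes {1..n} \<and> \<pi> ` {1..m} = {1..m} \<and> (\<forall>l. 0 < l \<and> l < m \<longrightarrow> \<pi> ` {1..l} \<noteq> {1..l})}" for m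
  have finT: "finite (T m)" for m
    by (rule finite_subset[OF _ finite_permutations[of "{1..n}"]]) (auto simp: T_def)
  have "{\<pi>. \<pi> permutes {1..n} \<and> sum_decomposable n \<pi>} = (\<Union>m\<in>{1..<n}. T m)"
  proof
    show "{\<pi>. \<pi> permutes {1..n} \<and> sum_decomposable n \<pi>} \<subseteq> (\<Union>m\<in>{1..<n}. T m)"
    proof
      fix \<pi> assume "\<pi> \<in> {\<pi>. \<pi> permutes {1..n} \<and> sum_decomposable n \<pi>}"
      then have \<pi>: "\<pi> permutes {1..n}" "\<exists>m. 0 < m \<and> m < n \<and> \<pi> ` {1..m} = {1..m}"
        unfolding sum_decomposable_def by auto
      define m where "m = (LEAST m. 0 < m \<and> m < n \<and> \<pi> ` {1..m} = {1..m})"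
      have m: "0 < m" "m < n" "\<pi> ` {1..m} = {1..m}" using LeastI_ex[OF \<pi>(2)] unfolding m_def by auto
      moreover have "\<pi> ` {1..l} \<noteq> {1..l}" if "0 < l" "l < m" for l
      proof -
        have "\<not> (0 < l \<and> l < n \<and> \<pi> ` {1..l} = {1..l})" using that unfolding m_def by (intro not_less_Least)
        then show ?thesis using that m by auto
      qed
      ultimately have "\<pi> \<in> T m" using \<pi>(1) unfolding T_def by blast
      then show "\<pi> \<in> (\<Union>m\<in>{1..<n}. T m)" using m by auto
    qed
    show "(\<Union>m\<in>{1..<n}. T m) \<subseteq> {\<pi>. \<pi> permutes {1..n} \<and> sum_decomposable n \<pi>}"
    proof
      fix \<pi> assume "\<pi> \<in> (\<Union>m\<in>{1..<n}. T m)"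
      then obtain m where "m \<in> {1..<n}" "\<pi> \<in> T m" by blast
      then have "0 < m" "m < n" "\<pi> permutes {1..n}" "\<pi> ` {1..m} = {1..m}" unfolding T_def by auto
      then show "\<pi> \<in> {\<pi>. \<pi> permutes {1..n} \<and> sum_decomposable n \<pi>}" unfolding sum_decomposable_def by blast
    qed
  qed
  then have "num_sum_decomposable n = card (\<Union>m\<in>{1..<n}. T m)" by (simp only: num_sum_decomposable_def)
  also have "\<dots> = (\<Sum>m=1..<n. card (T m))"
  proof (rule card_UN_disjoint)
    have "T m \<inter> T l = {}" if "0 < m" "m < l" for m l using that unfolding T_def by blast
    then show "\<forall>m\<in>{1..<n}. \<forall>l\<in>{1..<n}. m \<noteq> l \<longrightarrow> T m \<inter> T l = {}"
      by (metis Int_commute One_nat_def Suc_le_eq atLeastLessThan_iff linorder_neqE_nat)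
  qed (use finT in auto)
  finally show ?thesis
    using card_permutes_first_component[of _ n] unfolding T_def by (simp add: Suc_le_eq cong: sum.cong_simp)
qed

text \<open>Reversing the order of the values exchanges the two kinds of decomposition.\<close>

lemma card_skew_decomposable:
  "card {\<pi>. \<pi> permutes {1..n} \<and> skew_decomposable n \<pi>} = num_sum_decomposable n"
proof -
  define r where "r x = (if x \<in> {1..n} then Suc n - x else x)" for x
  have rr: "r (r x) = x" for x unfolding r_def by auto
  have r_img: "r ` {1..m} = {Suc (n - m)..n}" "r ` {Suc (n - m)..n} = {1..m}" if "m < n" for m
  proof -
    show 1: "r ` {1..m} = {Suc (n - m)..n}"
    proof
      show "r ` {1..m} \<subseteq> {Suc (n - m)..n}" using that by (auto simp: r_def)
      show "{Suc (n - m)..n} \<subseteq> r ` {1..m}"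
      proof
        fix x assume "x \<in> {Suc (n - m)..n}"
        then have "r x \<in> {1..m}" using that by (auto simp: r_def)
        then show "x \<in> r ` {1..m}" using rr by (metis imageI)
      qed
    qed
    show "r ` {Suc (n - m)..n} = {1..m}" unfolding 1[symmetric] by (simp add: image_image rr)
  qed
  have "inj r" using rr by (metis injI)
  moreover have "r x \<in> {1..n}" if "x \<in> {1..n}" for x using that by (auto simp: r_def)
  ultimately have rperm: "r permutes {1..n}"
    by (intro inj_imp_permutes) (auto simp: r_def intro: inj_on_subset)
  have comp: "(r \<circ> \<pi>) permutes {1..n}" if "\<pi> permutes {1..n}" for \<pi>
    by (rule permutes_compose[OF that rperm])
  have "bij_betw ((\<circ>) r) {\<pi>. \<pi> permutes {1..n} \<and> skew_decomposable n \<pi>} {\<pi>. \<pi> permutes {1..n} \<and> sum_decomposable n \<pi>}"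
  proof (rule bij_betw_byWitness[where f' = "(\<circ>) r"])
    show "(\<circ>) r ` {\<pi>. \<pi> permutes {1..n} \<and> skew_decomposable n \<pi>} \<subseteq> {\<pi>. \<pi> permutes {1..n} \<and> sum_decomposable n \<pi>}"
    proof clarify
      fix \<pi> assume \<pi>: "\<pi> permutes {1..n}" "skew_decomposable n \<pi>"
      then obtain m where m: "0 < m" "m < n" "\<pi> ` {1..m} = {Suc (n - m)..n}" unfolding skew_decomposable_def by blast
      then have "(r \<circ> \<pi>) ` {1..m} = {1..m}" unfolding image_comp[symmetric] m(3) r_img(2)[OF m(2)] by simp
      then show "r \<circ> \<pi> permutes {1..n} \<and> sum_decomposable n (r \<circ> \<pi>)"
        using m comp[OF \<pi>(1)] unfolding sum_decomposable_def by blast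
    qed
    show "(\<circ>) r ` {\<pi>. \<pi> permutes {1..n} \<and> sum_decomposable n \<pi>} \<subseteq> {\<pi>. \<pi> permutes {1..n} \<and> skew_decomposable n \<pi>}"
    proof clarify
      fix \<pi> assume \<pi>: "\<pi> permutes {1..n}" "sum_decomposable n \<pi>"
      then obtain m where m: "0 < m" "m < n" "\<pi> ` {1..m} = {1..m}" unfolding sum_decomposable_def by blast
      then have "(r \<circ> \<pi>) ` {1..m} = {Suc (n - m)..n}" unfolding image_comp[symmetric] m(3) r_img(1)[OF m(2)] by simp
      then show "r \<circ> \<pi> permutes {1..n} \<and> skew_decomposable n (r \<circ> \<pi>)"
        using m comp[OF \<pi>(1)] unfolding skew_decomposable_def by blast
    qed
  qed (simp_all add: fun_eq_iff rr)
  then show ?thesis unfolding num_sum_decomposable_def by (rule bij_betw_same_card)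
qed

text \<open>The recursion says \<open>D = (F - D) F\<close> for the generating function \<open>D\<close> of the sum decomposable
  permutations, that is, \<open>D = F\<^sup>2 / (1 + F)\<close>. To stay within integer coefficients, the series
  \<open>X\<^sup>2 / (1 + X)\<close> is written out as \<open>E\<close> and composed with \<open>F\<close>.\<close>

lemma num_sum_decomposable_eq:
  "int (num_sum_decomposable n) = (\<Sum>k=2..n. (- 1) ^ k * (fact_fps ^ k) $ n)"
proof -
  let ?F = fact_fps
  define D :: "int fps" where "D = Abs_fps (\<lambda>n. int (num_sum_decomposable n))"
  define E :: "int fps" where "E = Abs_fps (\<lambda>k. if k < 2 then 0 else (- 1) ^ k)"
  have F0: "?F $ 0 = 0" by (simp add: fact_fps_def)
  have "D = (?F - D) * ?F"
  proof (rule fps_ext)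
    fix n
    have D0: "(?F - D) $ 0 = 0" using num_sum_decomposable_rec[of 0] by (simp add: D_def fact_fps_def)
    have "((?F - D) * ?F) $ n = (\<Sum>m=0..n. (?F - D) $ m * ?F $ (n - m))" by (rule fps_mult_nth)
    also have "\<dots> = (\<Sum>m=1..<n. (?F - D) $ m * ?F $ (n - m))"
    proof (rule sum.mono_neutral_right)
      show "\<forall>m\<in>{0..n} - {1..<n}. (?F - D) $ m * ?F $ (n - m) = 0"
      proof
        fix m assume "m \<in> {0..n} - {1..<n}"
        then have "m = 0 \<or> m = n" by auto
        then show "(?F - D) $ m * ?F $ (n - m) = 0" using D0 F0 by (metis diff_self_eq_0 mult_zero_left mult_zero_right)
      qed
    qed auto
    also have "\<dots> = (\<Sum>m=1..<n. (fact m - int (num_sum_decomposable m)) * fact (n - m))"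
      by (intro sum.cong refl) (auto simp: D_def fact_fps_def)
    also have "\<dots> = D $ n" using num_sum_decomposable_rec[of n] by (simp add: D_def)
    finally show "D $ n = ((?F - D) * ?F) $ n" by simp
  qed
  then have D: "D * (1 + ?F) = ?F ^ 2" by (simp add: algebra_simps power2_eq_square)
  have "E * (1 + fps_X) = fps_X ^ 2"
  proof (rule fps_ext)
    fix n
    have "(E * (1 + fps_X)) $ n = E $ n + (if n = 0 then 0 else E $ (n - 1))"
      by (simp add: fps_mult_fps_X_plus_1_nth mult.commute[of E])
    also have "\<dots> = (fps_X ^ 2) $ n"
    proof -
      consider "n = 0" | "n = 1" | "n = 2" | m where "n = Suc (Suc (Suc m))"
        by (metis One_nat_def Suc_1 not0_implies_Suc)
      then show ?thesis by cases (simp_all add: E_def fps_X_power_nth)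
    qed
    finally show "(E * (1 + fps_X)) $ n = (fps_X ^ 2) $ n" .
  qed
  then have "(E * (1 + fps_X)) oo ?F = (fps_X ^ 2) oo ?F" by simp
  then have "(E oo ?F) * (1 + ?F) = ?F ^ 2"
    by (simp add: fps_compose_mult_distrib F0 fps_compose_add_distrib fps_compose_power power2_eq_square)
  moreover have "(1 + ?F) $ 0 = 1" using F0 by simp
  then have "1 + ?F \<noteq> 0" by (metis fps_zero_nth zero_neq_one)
  ultimately have "D = E oo ?F" using D by (metis mult_right_cancel)
  then have "int (num_sum_decomposable n) = (\<Sum>k=0..n. E $ k * (?F ^ k) $ n)"
    by (metis D_def fps_compose_nth fps_nth_Abs_fps)
  also have "\<dots> = (\<Sum>k=2..n. E $ k * (?F ^ k) $ n)"
    by (rule sum.mono_neutral_right) (auto simp: E_def)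
  also have "\<dots> = (\<Sum>k=2..n. (- 1) ^ k * (?F ^ k) $ n)"
    by (intro sum.cong refl) (simp add: E_def)
  finally show ?thesis .
qed

section \<open>Divisibility by powers of two\<close>

text \<open>The decomposition into sums, skew sums and inflations of simple permutations of length at least
  \<open>3\<close>, counted. The two alternating series for the sums and the skew sums coincide, which gives the
  summand \<open>2 * (- 1) ^ k\<close>.\<close>

lemma fact_eq_sum_simple:
  assumes "n \<ge> 2"
  defines "t \<equiv> \<lambda>k. 2 * (- 1) ^ k + (if k \<ge> 3 then int (num_simple k) else 0)"
  shows "fact n = (\<Sum>k=2..n. t k * (fact_fps ^ k) $ n)"
proof -
  let ?S = "{\<pi>. \<pi> permutes {1..n} \<and> sum_decomposable n \<pi>}"
  let ?K = "{\<pi>. \<pi> permutes {1..n} \<and> skew_decomposable n \<pi>}"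
  let ?I = "{\<pi>. \<pi> permutes {1..n} \<and> \<not> decomposable n \<pi>}"
  have fin: "finite ?S" "finite ?K" "finite ?I"
    by (rule finite_subset[OF _ finite_permutations[of "{1..n}"]]; auto)+
  have eq: "{\<pi>. \<pi> permutes {1..n}} = ?S \<union> ?K \<union> ?I" using decomposable_iff by blast
  have "fact n = card {\<pi>. \<pi> permutes {1..n}}" by (simp add: card_permutations[OF refl])
  also have "\<dots> = card (?S \<union> ?K \<union> ?I)" by (rule arg_cong[OF eq])
  also have "\<dots> = card (?S \<union> ?K) + card ?I"
    using fin by (intro card_Un_disjoint) (use decomposable_iff in blast)+
  also have "card (?S \<union> ?K) = card ?S + card ?K"
    using fin not_sum_and_skew_decomposable by (intro card_Un_disjoint) blast+
  finally have "fact n = 2 * int (num_sum_decomposable n) + int (card ?I)"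
    unfolding card_skew_decomposable num_sum_decomposable_def[symmetric] by (metis (no_types) mult_2 of_nat_add of_nat_fact)
  also have "int (card ?I) = (\<Sum>k=3..n. int (num_simple k) * (fact_fps ^ k) $ n)"
    unfolding card_indecomposable[OF assms(1)] of_nat_sum of_nat_mult
    unfolding of_nat_sum[symmetric] sum_interval_partitions ..
  also have "\<dots> = (\<Sum>k=2..n. (if k \<ge> 3 then int (num_simple k) else 0) * (fact_fps ^ k) $ n)"
    by (intro sum.mono_neutral_cong_left) auto
  finally show ?thesis
    unfolding num_sum_decomposable_eq t_def by (simp add: algebra_simps sum.distrib sum_distrib_left)
qed

lemma power_2_dvd_fact: "(2 :: int) ^ (n div 2) dvd fact n"
proof (induction n rule: less_induct)
  case (less n)
  show ?case
  proof (cases "n < 2")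
    case False
    then obtain m where "n = 2 + m" using le_Suc_ex[of 2 n] by auto
    then have n: "n = Suc (Suc m)" by simp
    have "(2 :: int) dvd (int m + 1) * (int m + 2)" by simp
    then have "2 ^ (m div 2) * (2 :: int) dvd fact m * ((int m + 1) * (int m + 2))"
      using less.IH[of m] n by (intro mult_dvd_mono) auto
    then show ?thesis unfolding n by (simp add: algebra_simps)
  qed simp
qed

text \<open>The coefficient is a sum of products of \<open>k\<close> factorials \<open>fact m\<close> with the \<open>m\<close> adding up to \<open>n\<close>, and
  each factor contributes \<open>m div 2\<close>, which is at least \<open>(m - 1) / 2\<close>. The exponent is
  \<open>(n - k) / 2\<close> rounded up.\<close>

lemma power_2_dvd_fact_fps_power: "2 ^ ((n + 1 - k) div 2) dvd (fact_fps ^ k) $ n"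
proof (induction k arbitrary: n)
  case 0
  show ?case by (cases n) auto
next
  case (Suc k)
  have "2 ^ ((n + 1 - Suc k) div 2) dvd fact_fps $ m * (fact_fps ^ k) $ (n - m)" if "m \<le> n" for m
  proof (cases "m = 0")
    case True
    then show ?thesis by (simp add: fact_fps_def)
  next
    case False
    have half: "(a + b) div 2 \<le> a div 2 + Suc b div 2" for a b :: nat by presburger
    have "(n + 1 - Suc k) div 2 \<le> m div 2 + (n - m + 1 - k) div 2"
    proof (cases "n - m + 1 \<le> k")
      case True
      then have "n + 1 - Suc k \<le> m" using that by linarith
      then show ?thesis by (simp add: div_le_mono trans_le_add1)
    next
      case False
      then have "k \<le> n - m" by simp
      then obtain e where "n - m = k + e" by (metis le_Suc_ex)
      then have "n + 1 - Suc k = m + e" "n - m + 1 - k = Suc e" using that by simp_all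
      then show ?thesis using half[of m e] by metis
    qed
    then have "(2 :: int) ^ ((n + 1 - Suc k) div 2) dvd 2 ^ (m div 2) * 2 ^ ((n - m + 1 - k) div 2)"
      by (simp add: le_imp_power_dvd flip: power_add)
    also have "\<dots> dvd fact_fps $ m * (fact_fps ^ k) $ (n - m)"
      using False Suc.IH power_2_dvd_fact[of m] by (intro mult_dvd_mono) (auto simp: fact_fps_def)
    finally show ?thesis .
  qed
  then show ?case unfolding power_Suc fps_mult_nth by (intro dvd_sum) auto
qed

text \<open>The coefficient of \<open>X ^ n\<close> in \<open>F ^ n\<close> is \<open>1\<close>, so that the identity \<open>fact_eq_sum_simple\<close> can be
  solved for the last summand. In the other ones the exponents \<open>k div 2\<close> and
  \<open>(n + 1 - k) div 2\<close> add up to at least \<open>n div 2\<close>.\<close>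

lemma power_2_dvd_num_simple:
  assumes "n \<ge> 2"
  shows "2 ^ (n div 2) dvd 2 * (- 1) ^ n + (if n \<ge> 3 then int (num_simple n) else 0)"
  using assms
proof (induction n rule: less_induct)
  case (less n)
  define t where "t k = 2 * (- 1) ^ k + (if k \<ge> 3 then int (num_simple k) else 0)" for k
  have split: "{2..n} = insert n {2..<n}" using less.prems by auto
  have "(fact_fps ^ n) $ n = 1"
    by (subst startsby_zero_power_nth_same) (simp_all add: fact_fps_def)
  then have "fact n = (\<Sum>k=2..<n. t k * (fact_fps ^ k) $ n) + t n"
    using fact_eq_sum_simple[OF less.prems] by (simp add: split t_def)
  then have "t n = fact n - (\<Sum>k=2..<n. t k * (fact_fps ^ k) $ n)" by simp
  also have "2 ^ (n div 2) dvd \<dots>"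
  proof (intro dvd_diff power_2_dvd_fact dvd_sum)
    fix k assume k: "k \<in> {2..<n}"
    have "n div 2 \<le> k div 2 + (n + 1 - k) div 2" using k by auto
    then have "(2 :: int) ^ (n div 2) dvd 2 ^ (k div 2) * 2 ^ ((n + 1 - k) div 2)"
      by (simp add: le_imp_power_dvd flip: power_add)
    also have "\<dots> dvd t k * (fact_fps ^ k) $ n"
      using k less.IH[of k] power_2_dvd_fact_fps_power unfolding t_def by (intro mult_dvd_mono) auto
    finally show "2 ^ (n div 2) dvd t k * (fact_fps ^ k) $ n" .
  qed
  finally show ?case unfolding t_def .
qed

theorem corollary12:
  fixes n :: nat
  assumes "n \<ge> 3"
  shows "(odd n \<longrightarrow> [int (num_simple n) = 2] (mod 2 ^ ((n - 1) div 2))) \<and>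
         (even n \<longrightarrow> [int (num_simple n) = - 2] (mod 2 ^ (n div 2)))"
proof -
  have dvd: "2 ^ (n div 2) dvd 2 * (- 1) ^ n + int (num_simple n)"
    using power_2_dvd_num_simple[of n] assms by simp
  show ?thesis
  proof (intro conjI impI)
    assume "odd n"
    then show "[int (num_simple n) = 2] (mod 2 ^ ((n - 1) div 2))"
      using dvd by (auto simp: cong_iff_dvd_diff elim!: oddE)
  next
    assume "even n"
    then show "[int (num_simple n) = - 2] (mod 2 ^ (n div 2))"
      using dvd by (simp add: cong_iff_dvd_diff add.commute)
  qed
qed

end
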